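(* There exist universal constants $c_2,c_\varepsilon>0$ such that the following holds. Consider any integers $S\ge2$, $A\ge2$, $B\ge2$, any $\gamma\in[\frac23,1)$ and any $C^\star_{\mathsf{clipped}}\ge\frac{2AB}{S(A+B)}$, and let $\mathsf{MG}(C^\star_{\mathsf{clipped}})$ be the set of all triples $\{\mathcal{MG},\rho,d_{\mathsf b}\}$ where $\mathcal{MG}$ is a $\gamma$-discounted two-player zero-sum Markov game with $|\mathcal S|=S$, $|\mathcal A|=A$, $|\mathcal B|=B$, $\rho\in\Delta(\mathcal S)$, $d_{\mathsf b}\in\Delta(\mathcal S\times\mathcal A\times\mathcal B)$, and there exists a Nash equilibrium $(\mu^\star,\nu^\star)$ of $\mathcal{MG}$ such that $$\max\Big\{\sup_{\mu,s,a,b}\frac{\min\{d^{\mu,\nu^\star}(s,a,b;\rho),\frac1{S(A+B)}\}}{d_{\mathsf b}(s,a,b)},\ \sup_{\nu,s,a,b}\frac{\min\{d^{\mu^\star,\nu}(s,a,b;\rho),\frac1{S(A+B)}\}}{d_{\mathsf b}(s,a,b)}\Big\}=C^\star_{\mathsf{clipped}} .$$ Then for any $\varepsilon\in\big(0,\frac1{c_\varepsilon(1-\gamma)\log(A+B)}\big]$, if the sample size obeys $$N<\frac{c_2\,S(A+B)\,C^\star_{\mathsf{clipped}}}{(1-\gamma)^3\varepsilon^2\log(A+B)},$$ then $$\inf_{(\widehat\mu,\widehat\nu)}\ \sup_{\{\mathcal{MG},\rho,d_{\mathsf b}\}\in\mathsf{MG}(C^\star_{\mathsf{clipped}})}\mathbb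 E\big[V^{\star,\widehat\nu}(\rho)-V^{\widehat\mu,\star}(\rho)\big]\ \ge\ \varepsilon ,$$ where the infimum is over all estimators $(\widehat\mu,\widehat\nu)$ (policy pairs that are measurable functions of the dataset) based on the offline dataset $\{(s_i,a_i,b_i,s_i')\}_{i=1}^N$.
   Context: **Markov game.** $\mathcal{MG}=(\mathcal S,\mathcal A,\mathcal B,P,r,\gamma)$: finite state space $\mathcal S$, finite action sets $\mathcal A$ (max-player) and $\mathcal B$ (min-player), transition kernel $P:\mathcal S\times\mathcal A\times\mathcal B\to\Delta(\mathcal S)$, reward $r:\mathcal S\times\mathcal A\times\mathcal B\to[0,1]$, discount $\gamma\in(0,1)$. $\Delta(\cdot)$ is the probability simplex. Stationary policies are $\mu:\mathcal S\to\Delta(\mathcal A)$, $\nu:\mathcal S\to\Delta(\mathcal B)$. $V^{\mu,\nu}(s)=\mathbb E[\sum_{t\ge0}\gamma^t r(s_t,a_t,b_t)\mid s_0=s]$, where $a_t\sim\mu(\cdot\mid s_t)$, $b_t\sim\nu(\cdot\mid s_t)$ are independent given the past and $s_{t+1}\sim P(\cdot\mid s_t,a_t,b_t)$. $V^{\mu,\star}(s)=\min_\nu V^{\mu,\nu}(s)$, $V^{\star,\nu}(s)=\max_\mu V^{\mu,\nu}(s)$. A Nash equilibrium is a pair $(\mu^\star,\nu^\star)$ with $V^{\mu,\nu^\star}\le V^{\mu^\star,\nu^\star}\le V^{\mu^\star,\nu}$ (all states) for all $\mu,\nu$. For $\rho\in\Delta(\mathcal S)$ and a function $V$ on $\mathcal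 S$, $V(\rho)=\mathbb E_{s\sim\rho}[V(s)]$. Occupancy measure: $d^{\mu,\nu}(s,a,b;\rho)=(1-\gamma)\sum_{t\ge0}\gamma^t\,\mathbb P(s_t=s,a_t=a,b_t=b\mid s_0\sim\rho;\mu,\nu)$. Convention $0/0=0$. **Offline data.** The dataset consists of $N$ independent transitions $(s_i,a_i,b_i,s_i')$, with $(s_i,a_i,b_i)\sim d_{\mathsf b}$ and $s_i'\sim P(\cdot\mid s_i,a_i,b_i)$. The expectation is over the dataset. *)

theory Defs
  imports "HOL-Probability.Probability"
begin

text \<open>
  States and actions of both players are the initial segments
  \<open>{..<n_states G}\<close>, \<open>{..<n_acts_max G}\<close>, \<open>{..<n_acts_min G}\<close> of the naturals, so that the
  cardinalities can be quantified over inside a formula. An element of \<open>\<Delta>(X)\<close> is a \<open>pmf\<close> whose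
  support lies in \<open>X\<close>. Values of the fields outside these segments are irrelevant.
\<close>

record game =
  n_states :: nat
  n_acts_max :: nat
  n_acts_min :: nat
  transition :: "nat \<Rightarrow> nat \<Rightarrow> nat \<Rightarrow> nat pmf"
  reward :: "nat \<Rightarrow> nat \<Rightarrow> nat \<Rightarrow> real"
  discount :: real

definition markov_game :: "game \<Rightarrow> bool" where
  "markov_game G \<longleftrightarrow>
     0 < n_states G \<and> 0 < n_acts_max G \<and> 0 < n_acts_min G \<and>
     0 < discount G \<and> discount G < 1 \<and>
     (\<forall>s<n_states G. \<forall>a<n_acts_max G. \<forall>b<n_acts_min G.
        set_pmf (transition G s a b) \<subseteq> {..<n_states G} \<and>
        0 \<le> reward G s a b \<and> reward G s a b \<le> 1)"

type_synonym policy = "nat \<Rightarrow> nat pmf"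

definition policies :: "nat \<Rightarrow> nat \<Rightarrow> policy set" where
  "policies S K = {\<pi>. \<forall>s<S. set_pmf (\<pi> s) \<subseteq> {..<K}}"

abbreviation max_policies :: "game \<Rightarrow> policy set" where
  "max_policies G \<equiv> policies (n_states G) (n_acts_max G)"

abbreviation min_policies :: "game \<Rightarrow> policy set" where
  "min_policies G \<equiv> policies (n_states G) (n_acts_min G)"


subsection \<open>The trajectory process\<close>

definition play :: "policy \<Rightarrow> policy \<Rightarrow> nat \<Rightarrow> (nat \<times> nat \<times> nat) pmf" where
  "play \<mu> \<nu> s = map_pmf (\<lambda>(a, b). (s, a, b)) (pair_pmf (\<mu> s) (\<nu> s))"

text \<open>Conditional law of \<open>(s\<^sub>t, a\<^sub>t, b\<^sub>t)\<close> given the history \<open>\<omega> 0, \<dots>, \<omega> (t - 1)\<close>.\<close>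

definition step :: "game \<Rightarrow> policy \<Rightarrow> policy \<Rightarrow> nat pmf \<Rightarrow>
    nat \<Rightarrow> (nat \<Rightarrow> nat \<times> nat \<times> nat) \<Rightarrow> (nat \<times> nat \<times> nat) measure" where
  "step G \<mu> \<nu> \<rho> t \<omega> = measure_pmf
     (case t of
        0 \<Rightarrow> bind_pmf \<rho> (play \<mu> \<nu>)
      | Suc k \<Rightarrow> (case \<omega> k of (s, a, b) \<Rightarrow> bind_pmf (transition G s a b) (play \<mu> \<nu>)))"

text \<open>
  Law of the whole trajectory \<open>((s\<^sub>t, a\<^sub>t, b\<^sub>t))\<^sub>t\<close> with \<open>s\<^sub>0 \<sim> \<rho>\<close>: the Ionescu-Tulcea extension of
  \<open>step\<close>, whose existence hypotheses are verified in \<open>Ionescu_Tulcea_step\<close>.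
\<close>

definition trajectory :: "game \<Rightarrow> policy \<Rightarrow> policy \<Rightarrow> nat pmf \<Rightarrow>
    (nat \<Rightarrow> nat \<times> nat \<times> nat) measure" where
  "trajectory G \<mu> \<nu> \<rho> =
     projective_family.lim UNIV
       (Ionescu_Tulcea.CI (step G \<mu> \<nu> \<rho>) (\<lambda>_. count_space UNIV)) (\<lambda>_. count_space UNIV)"

lemma Ionescu_Tulcea_step: "Ionescu_Tulcea (step G \<mu> \<nu> \<rho>) (\<lambda>_. count_space UNIV)"
proof (rule Ionescu_Tulcea.intro)
  fix i
  show "step G \<mu> \<nu> \<rho> i \<in> measurable (PiM {0..<i} (\<lambda>_. count_space UNIV)) (subprob_algebra (count_space UNIV))"
  proof (cases i)
    case 0
    then show ?thesis
      by (auto simp: step_def[abs_def] space_subprob_algebra measure_pmf.subprob_space_axioms)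
  next
    case (Suc k)
    let ?f = "\<lambda>x. measure_pmf (case x of (s, a, b) \<Rightarrow> bind_pmf (transition G s a b) (play \<mu> \<nu>))"
    have "(\<lambda>\<omega>. \<omega> k) \<in> measurable (PiM {0..<i} (\<lambda>_. count_space UNIV)) (count_space (UNIV :: (nat \<times> nat \<times> nat) set))"
      using Suc by (intro measurable_component_singleton) auto
    moreover have "?f \<in> measurable (count_space UNIV) (subprob_algebra (count_space UNIV))"
      by (auto simp: space_subprob_algebra measure_pmf.subprob_space_axioms)
    ultimately have "(\<lambda>\<omega>. ?f (\<omega> k)) \<in> measurable (PiM {0..<i} (\<lambda>_. count_space UNIV)) (subprob_algebra (count_space UNIV))"
      by (rule measurable_compose)
    then show ?thesis
      using Suc by (simp add: step_def[abs_def])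
  qed
next
  fix i x
  show "prob_space (step G \<mu> \<nu> \<rho> i x)"
    by (simp add: step_def measure_pmf.prob_space_axioms)
qed


subsection \<open>Values, equilibria and occupancy measures\<close>

definition V :: "game \<Rightarrow> policy \<Rightarrow> policy \<Rightarrow> nat \<Rightarrow> real" where
  "V G \<mu> \<nu> s =
     (\<integral>\<omega>. (\<Sum>t. discount G ^ t * (case \<omega> t of (s', a, b) \<Rightarrow> reward G s' a b))
        \<partial>trajectory G \<mu> \<nu> (return_pmf s))"

text \<open>
  Best-response values \<open>V\<^sup>\<mu>\<^sup>,\<^sup>\<star>\<close> and \<open>V\<^sup>\<star>\<^sup>,\<^sup>\<nu>\<close>. The extrema are over nonempty sets of values in
  \<open>[0, 1 / (1 - \<gamma>)]\<close>.
\<close>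

definition V_min :: "game \<Rightarrow> policy \<Rightarrow> nat \<Rightarrow> real" where
  "V_min G \<mu> s = (INF \<nu>\<in>min_policies G. V G \<mu> \<nu> s)"

definition V_max :: "game \<Rightarrow> policy \<Rightarrow> nat \<Rightarrow> real" where
  "V_max G \<nu> s = (SUP \<mu>\<in>max_policies G. V G \<mu> \<nu> s)"

definition nash_equilibrium :: "game \<Rightarrow> policy \<Rightarrow> policy \<Rightarrow> bool" where
  "nash_equilibrium G \<mu>' \<nu>' \<longleftrightarrow>
     \<mu>' \<in> max_policies G \<and> \<nu>' \<in> min_policies G \<and>
     (\<forall>\<mu>\<in>max_policies G. \<forall>\<nu>\<in>min_policies G. \<forall>s<n_states G.
        V G \<mu> \<nu>' s \<le> V G \<mu>' \<nu>' s \<and> V G \<mu>' \<nu>' s \<le> V G \<mu>' \<nu> s)"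

definition occupancy :: "game \<Rightarrow> policy \<Rightarrow> policy \<Rightarrow> nat pmf \<Rightarrow> nat \<times> nat \<times> nat \<Rightarrow> real" where
  "occupancy G \<mu> \<nu> \<rho> x =
     (1 - discount G) *
     (\<Sum>t. discount G ^ t * \<P>(\<omega> in trajectory G \<mu> \<nu> \<rho>. \<omega> t = x))"


subsection \<open>Clipped concentrability\<close>

text \<open>
  Division is that of \<open>ennreal\<close>: \<open>0 / 0 = 0\<close>, whereas \<open>x / 0 = \<infinity>\<close> for \<open>x > 0\<close>
  (real division would make uncovered triples free).
\<close>

definition clipped_ratio :: "game \<Rightarrow> nat pmf \<Rightarrow> (nat \<times> nat \<times> nat) pmf \<Rightarrow>
    policy \<Rightarrow> policy \<Rightarrow> nat \<times> nat \<times> nat \<Rightarrow> ennreal" where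
  "clipped_ratio G \<rho> d\<^sub>b \<mu> \<nu> x =
     ennreal (min (occupancy G \<mu> \<nu> \<rho> x)
                  (1 / (real (n_states G) * (real (n_acts_max G) + real (n_acts_min G)))))
     / ennreal (pmf d\<^sub>b x)"

definition triples :: "game \<Rightarrow> (nat \<times> nat \<times> nat) set" where
  "triples G = {..<n_states G} \<times> {..<n_acts_max G} \<times> {..<n_acts_min G}"

definition clipped_concentrability :: "game \<Rightarrow> nat pmf \<Rightarrow> (nat \<times> nat \<times> nat) pmf \<Rightarrow>
    policy \<Rightarrow> policy \<Rightarrow> ennreal" where
  "clipped_concentrability G \<rho> d\<^sub>b \<mu>' \<nu>' =
     max (SUP \<mu>\<in>max_policies G. SUP x\<in>triples G. clipped_ratio G \<rho> d\<^sub>b \<mu> \<nu>' x)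
         (SUP \<nu>\<in>min_policies G. SUP x\<in>triples G. clipped_ratio G \<rho> d\<^sub>b \<mu>' \<nu> x)"

definition MG :: "nat \<Rightarrow> nat \<Rightarrow> nat \<Rightarrow> real \<Rightarrow> real \<Rightarrow>
    (game \<times> nat pmf \<times> (nat \<times> nat \<times> nat) pmf) set" where
  "MG S A B \<gamma> C =
     {(G, \<rho>, d\<^sub>b).
        markov_game G \<and> n_states G = S \<and> n_acts_max G = A \<and> n_acts_min G = B \<and> discount G = \<gamma> \<and>
        set_pmf \<rho> \<subseteq> {..<S} \<and> set_pmf d\<^sub>b \<subseteq> triples G \<and>
        (\<exists>\<mu>' \<nu>'. nash_equilibrium G \<mu>' \<nu>' \<and>
                 clipped_concentrability G \<rho> d\<^sub>b \<mu>' \<nu>' = ennreal C)}"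


subsection \<open>Offline data and estimators\<close>

type_synonym dataset = "(nat \<times> nat \<times> nat \<times> nat) list"

definition sample :: "game \<Rightarrow> (nat \<times> nat \<times> nat) pmf \<Rightarrow> (nat \<times> nat \<times> nat \<times> nat) pmf" where
  "sample G d\<^sub>b =
     bind_pmf d\<^sub>b (\<lambda>(s, a, b). map_pmf (\<lambda>s'. (s, a, b, s')) (transition G s a b))"

text \<open>The space of datasets is discrete, so every function of the dataset is measurable.\<close>

definition estimators :: "nat \<Rightarrow> nat \<Rightarrow> nat \<Rightarrow> (dataset \<Rightarrow> policy \<times> policy) set" where
  "estimators S A B = {est. \<forall>D. fst (est D) \<in> policies S A \<and> snd (est D) \<in> policies S B}"

definition duality_gap :: "game \<Rightarrow> nat pmf \<Rightarrow> policy \<times> policy \<Rightarrow> real" where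
  "duality_gap G \<rho> = (\<lambda>(\<mu>, \<nu>).
     measure_pmf.expectation \<rho> (V_max G \<nu>) - measure_pmf.expectation \<rho> (V_min G \<mu>))"

definition expected_gap :: "nat \<Rightarrow> (dataset \<Rightarrow> policy \<times> policy) \<Rightarrow>
    game \<times> nat pmf \<times> (nat \<times> nat \<times> nat) pmf \<Rightarrow> real" where
  "expected_gap N est = (\<lambda>(G, \<rho>, d\<^sub>b).
     measure_pmf.expectation (replicate_pmf N (sample G d\<^sub>b)) (\<lambda>D. duality_gap G \<rho> (est D)))"

end

theory Submission
  imports Defs
begin

text \<open>
  Since the clipping level is \<open>1 / (S (A + B))\<close>, a behaviour distribution giving a triple the mass
  \<open>1 / K\<close> with \<open>K = S (A + B) C\<close> is admissible, and \<open>K \<ge> 2 A B\<close> leaves room for this at all actions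
  in one state. So a two-point argument about a single unknown triple suffices. State \<open>0\<close> pays
  reward \<open>1\<close> until it is left for the absorbing state \<open>1\<close>, which pays \<open>0\<close>. The first column is dominant for the
  min-player; in it, row \<open>0\<close> stays with probability \<open>\<gamma> + \<delta>\<close> or \<open>\<gamma> - \<delta>\<close>, depending on the instance, and all
  other rows stay with probability \<open>\<gamma>\<close>. Hence row \<open>0\<close> is the best row in one game and
  the worst in the other, and any estimator loses order \<open>\<delta> / (1 - \<gamma>)\<^sup>2\<close> in one of them unless the
  data tell them apart. One sample has Bhattacharyya affinity at least
  \<open>1 - \<delta>\<^sup>2 / (\<gamma> (1 - \<gamma>) K)\<close>, so for \<open>\<delta>\<close> of order \<open>(1 - \<gamma>)\<^sup>2 \<epsilon>\<close> this takes \<open>N\<close> of order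
  \<open>K / ((1 - \<gamma>)\<^sup>3 \<epsilon>\<^sup>2)\<close>.
\<close>

subsection \<open>Marginals of the trajectory\<close>

text \<open>Law of the triple at time \<open>t\<close>, by iterating the one-step kernel. With
  discrete marginals available, all later computations avoid the measure on infinite
  trajectories.\<close>

primrec visit_pmf :: "game \<Rightarrow> policy \<Rightarrow> policy \<Rightarrow> nat pmf \<Rightarrow> nat \<Rightarrow> (nat \<times> nat \<times> nat) pmf" where
  "visit_pmf G \<mu> \<nu> \<rho> 0 = bind_pmf \<rho> (play \<mu> \<nu>)"
| "visit_pmf G \<mu> \<nu> \<rho> (Suc t) =
     bind_pmf (visit_pmf G \<mu> \<nu> \<rho> t) (\<lambda>(s, a, b). bind_pmf (transition G s a b) (play \<mu> \<nu>))"

text \<open>The kernel at time \<open>Suc t\<close> sees the history only through the triple at time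
  \<open>t\<close>, so integrating out the last coordinate leaves a function of that triple. The
  induction therefore keeps \<open>f\<close> arbitrary.\<close>

lemma nn_integral_Ionescu_Tulcea_C_step:
  fixes f :: "nat \<times> nat \<times> nat \<Rightarrow> ennreal"
  shows "(\<integral>\<^sup>+\<omega>. f (\<omega> t) \<partial>Ionescu_Tulcea.C (step G \<mu> \<nu> \<rho>) (\<lambda>_. count_space UNIV) 0 (Suc t) (\<lambda>_. undefined))
    = (\<integral>\<^sup>+x. f x \<partial>measure_pmf (visit_pmf G \<mu> \<nu> \<rho> t))"
proof (induction t arbitrary: f)
  interpret IT: Ionescu_Tulcea "step G \<mu> \<nu> \<rho>" "\<lambda>_. count_space UNIV"
    by (rule Ionescu_Tulcea_step)
  \<comment> \<open>Peels off the last kernel: \<open>eP t\<close> extends a history by coordinate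
    \<open>t\<close>, drawn from \<open>step\<close>.\<close>
  have *: "(\<integral>\<^sup>+\<omega>. f (\<omega> t) \<partial>IT.C 0 (Suc t) (\<lambda>_. undefined))
    = (\<integral>\<^sup>+\<omega>. \<integral>\<^sup>+x. f x \<partial>step G \<mu> \<nu> \<rho> t \<omega> \<partial>IT.C 0 t (\<lambda>_. undefined))" for t and f :: "nat \<times> nat \<times> nat \<Rightarrow> ennreal"
  proof -
    have m: "(\<lambda>\<omega>. f (\<omega> t)) \<in> borel_measurable (PiM {0..<Suc t} (\<lambda>_. count_space UNIV))"
      by (rule measurable_compose[OF measurable_component_singleton]) auto
    have e: "IT.eP t \<in> measurable (IT.C 0 t (\<lambda>_. undefined)) (subprob_algebra (PiM {0..<Suc t} (\<lambda>_. count_space UNIV)))"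
      using IT.measurable_eP[of t] by (subst measurable_cong_sets[OF IT.sets_C refl]) (auto simp: space_PiM)
    have "(\<integral>\<^sup>+\<omega>. f (\<omega> t) \<partial>IT.C 0 (Suc t) (\<lambda>_. undefined))
       = (\<integral>\<^sup>+\<omega>. \<integral>\<^sup>+y. f (y t) \<partial>IT.eP t \<omega> \<partial>IT.C 0 t (\<lambda>_. undefined))"
      by (simp add: nn_integral_bind[OF m e])
    also have "\<dots> = (\<integral>\<^sup>+\<omega>. \<integral>\<^sup>+x. f x \<partial>step G \<mu> \<nu> \<rho> t \<omega> \<partial>IT.C 0 t (\<lambda>_. undefined))"
      by (intro nn_integral_cong, subst IT.nn_integral_eP)
         (auto simp: IT.space_C space_PiM m)
    finally show ?thesis .
  qed
  { case 0
    show ?case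
      by (subst *) (simp add: step_def space_PiM sets_PiM_empty)
  next
    case (Suc t)
    have "(\<integral>\<^sup>+\<omega>. f (\<omega> (Suc t)) \<partial>IT.C 0 (Suc (Suc t)) (\<lambda>_. undefined))
       = (\<integral>\<^sup>+\<omega>. (\<lambda>z. \<integral>\<^sup>+x. f x \<partial>measure_pmf (case z of (s, a, b) \<Rightarrow> bind_pmf (transition G s a b) (play \<mu> \<nu>))) (\<omega> t)
            \<partial>IT.C 0 (Suc t) (\<lambda>_. undefined))"
      by (subst *) (simp add: step_def)
    also have "\<dots> = (\<integral>\<^sup>+x. f x \<partial>measure_pmf (visit_pmf G \<mu> \<nu> \<rho> (Suc t)))"
      by (subst Suc.IH) simp
    finally show ?case . }
qed

lemma sets_trajectory [measurable_cong]:
  "sets (trajectory G \<mu> \<nu> \<rho>) = sets (PiM UNIV (\<lambda>_. count_space UNIV))"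
proof -
  interpret IT: Ionescu_Tulcea "step G \<mu> \<nu> \<rho>" "\<lambda>_. count_space UNIV"
    by (rule Ionescu_Tulcea_step)
  show ?thesis by (simp add: trajectory_def)
qed

lemma space_trajectory [simp]: "space (trajectory G \<mu> \<nu> \<rho>) = UNIV"
  using sets_eq_imp_space_eq[OF sets_trajectory] by (simp add: space_PiM)

lemma measurable_trajectory_component [measurable]:
  "(\<lambda>\<omega>. \<omega> t) \<in> measurable (trajectory G \<mu> \<nu> \<rho>) (count_space UNIV)"
  by (subst measurable_cong_sets[OF sets_trajectory refl]) (rule measurable_component_singleton, simp)

text \<open>An event about time \<open>t\<close> is a cylinder over the initial segment
  \<open>{0..<Suc t}\<close>. On such a cylinder the projective limit agrees with \<open>CI\<close>,
  and \<open>CI\<close> with the finite composition of kernels \<open>C\<close>.\<close>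

lemma distr_trajectory:
  "distr (trajectory G \<mu> \<nu> \<rho>) (count_space UNIV) (\<lambda>\<omega>. \<omega> t) = measure_pmf (visit_pmf G \<mu> \<nu> \<rho> t)"
proof (rule measure_eqI)
  interpret IT: Ionescu_Tulcea "step G \<mu> \<nu> \<rho>" "\<lambda>_. count_space UNIV"
    by (rule Ionescu_Tulcea_step)
  fix X :: "(nat \<times> nat \<times> nat) set"
  let ?J = "{0..<Suc t}"
  let ?M = "\<lambda>_::nat. count_space UNIV :: (nat \<times> nat \<times> nat) measure"
  let ?Y = "{\<omega> \<in> space (PiM ?J ?M). \<omega> t \<in> X}"
  have m: "(\<lambda>\<omega>. \<omega> t) \<in> measurable (PiM ?J ?M) (count_space UNIV)"
    by (rule measurable_component_singleton) simp
  have Y: "?Y \<in> sets (PiM ?J ?M)"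
    using measurable_sets[OF m, of X] by (simp add: vimage_def Int_def conj_commute)
  have sC: "sets (IT.C 0 (Suc t) (\<lambda>_. undefined)) = sets (PiM ?J ?M)"
    using IT.sets_C[of "\<lambda>_. undefined" 0 "Suc t"] by (simp add: space_PiM)
  have "emeasure (distr (trajectory G \<mu> \<nu> \<rho>) (count_space UNIV) (\<lambda>\<omega>. \<omega> t)) X
      = emeasure (trajectory G \<mu> \<nu> \<rho>) (prod_emb UNIV ?M ?J ?Y)"
    by (subst emeasure_distr) (auto simp: prod_emb_def space_PiM intro!: arg_cong2[where f = emeasure])
  also have "\<dots> = emeasure (IT.CI ?J) ?Y"
    using IT.lim[OF _ Y] by (simp add: trajectory_def)
  also have "\<dots> = emeasure (IT.C 0 (Suc t) (\<lambda>_. undefined)) ?Y"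
    by (subst IT.emeasure_CI[OF subset_refl Y]) (use sets.sets_into_space[OF Y] in \<open>simp add: prod_emb_id space_PiM\<close>)
  also have "\<dots> = (\<integral>\<^sup>+\<omega>. indicator X (\<omega> t) \<partial>IT.C 0 (Suc t) (\<lambda>_. undefined))"
    by (subst nn_integral_indicator[symmetric])
       (auto simp: sC Y sets_eq_imp_space_eq[OF sC] simp del: IT.C.simps nn_integral_indicator
             intro!: nn_integral_cong split: split_indicator)
  also have "\<dots> = emeasure (visit_pmf G \<mu> \<nu> \<rho> t) X"
    by (subst nn_integral_Ionescu_Tulcea_C_step) simp
  finally show "emeasure (distr (trajectory G \<mu> \<nu> \<rho>) (count_space UNIV) (\<lambda>\<omega>. \<omega> t)) X
    = emeasure (visit_pmf G \<mu> \<nu> \<rho> t) X" .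
qed simp

lemma prob_space_trajectory: "prob_space (trajectory G \<mu> \<nu> \<rho>)"
  using distr_trajectory[of G \<mu> \<nu> \<rho> 0] measure_pmf.prob_space_axioms
  by (metis measurable_trajectory_component prob_space_distrD)

lemma integral_trajectory_component:
  fixes f :: "nat \<times> nat \<times> nat \<Rightarrow> real"
  shows "(\<integral>\<omega>. f (\<omega> t) \<partial>trajectory G \<mu> \<nu> \<rho>) = measure_pmf.expectation (visit_pmf G \<mu> \<nu> \<rho> t) f"
  unfolding distr_trajectory[symmetric] by (subst integral_distr) auto

lemma occupancy_eq:
  "occupancy G \<mu> \<nu> \<rho> x = (1 - discount G) * (\<Sum>t. discount G ^ t * pmf (visit_pmf G \<mu> \<nu> \<rho> t) x)"
proof -
  have "\<P>(\<omega> in trajectory G \<mu> \<nu> \<rho>. \<omega> t = x) = pmf (visit_pmf G \<mu> \<nu> \<rho> t) x" for t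
    using measure_distr[OF measurable_trajectory_component[of t G \<mu> \<nu> \<rho>], of "{x}"]
    by (simp add: distr_trajectory pmf.rep_eq vimage_def)
  then show ?thesis by (simp add: occupancy_def)
qed

text \<open>The discounted rewards are dominated by the geometric series with terms
  \<open>R * discount G ^ t\<close>, so expectation and sum commute and only the marginals
  matter.\<close>

lemma V_eq:
  assumes r: "\<And>s a b. \<bar>reward G s a b\<bar> \<le> R" and d: "0 \<le> discount G" "discount G < 1"
  shows "V G \<mu> \<nu> s = (\<Sum>t. discount G ^ t *
    measure_pmf.expectation (visit_pmf G \<mu> \<nu> (return_pmf s) t) (\<lambda>(s', a, b). reward G s' a b))"
proof -
  let ?T = "trajectory G \<mu> \<nu> (return_pmf s)"
  interpret prob_space ?T by (rule prob_space_trajectory)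
  define f where "f z = (case z of (s', a, b) \<Rightarrow> reward G s' a b)" for z
  have f: "\<bar>f z\<bar> \<le> R" for z
    by (auto simp: f_def r split: prod.split)
  have m: "(\<lambda>\<omega>. discount G ^ t * f (\<omega> t)) \<in> borel_measurable ?T" for t
    by (intro borel_measurable_times borel_measurable_const
        measurable_compose[OF measurable_trajectory_component]) auto
  have b: "norm (discount G ^ t * f z) \<le> R * discount G ^ t" for t z
    using mult_right_mono[OF f[of z], of "discount G ^ t"] d by (simp add: abs_mult mult.commute)
  have int: "integrable ?T (\<lambda>\<omega>. discount G ^ t * f (\<omega> t))" for t
    by (rule integrable_const_bound[where B = "R * discount G ^ t"]) (use b m in auto)
  have sm: "summable (\<lambda>t. R * discount G ^ t)"
    using d by (intro summable_mult summable_geometric) auto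
  have "V G \<mu> \<nu> s = (\<integral>\<omega>. (\<Sum>t. discount G ^ t * f (\<omega> t)) \<partial>?T)"
    by (simp add: V_def f_def)
  also have "\<dots> = (\<Sum>t. \<integral>\<omega>. discount G ^ t * f (\<omega> t) \<partial>?T)"
  proof (rule integral_suminf[OF int])
    show "AE \<omega> in ?T. summable (\<lambda>t. norm (discount G ^ t * f (\<omega> t)))"
      by (intro AE_I2 summable_comparison_test'[OF sm]) (use b in auto)
    have "norm (\<integral>\<omega>. norm (discount G ^ t * f (\<omega> t)) \<partial>?T) \<le> R * discount G ^ t" for t
    proof -
      have "(\<integral>\<omega>. norm (discount G ^ t * f (\<omega> t)) \<partial>?T) \<le> (\<integral>\<omega>. R * discount G ^ t \<partial>?T)"
        by (intro integral_mono integrable_norm int b) auto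
      then show ?thesis using prob_space by simp
    qed
    then show "summable (\<lambda>t. \<integral>\<omega>. norm (discount G ^ t * f (\<omega> t)) \<partial>?T)"
      by (intro summable_comparison_test'[OF sm]) auto
  qed
  also have "\<dots> = (\<Sum>t. discount G ^ t * measure_pmf.expectation (visit_pmf G \<mu> \<nu> (return_pmf s) t) f)"
    by (simp add: integral_trajectory_component)
  finally show ?thesis by (simp add: f_def[abs_def])
qed


subsection \<open>The hard games\<close>

text \<open>Probabilities are linear under mixing. This is what averages the stay probability over
  the random actions of a round.\<close>

lemma bind_bernoulli_pmf:
  assumes "\<And>z. z \<in> set_pmf P \<Longrightarrow> 0 \<le> f z \<and> f z \<le> 1"
  shows "bind_pmf P (\<lambda>z. bernoulli_pmf (f z)) = bernoulli_pmf (measure_pmf.expectation P f)"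
proof (rule pmf_eqI)
  have i: "integrable (measure_pmf P) f"
    by (rule measure_pmf.integrable_const_bound[where B = 1]) (use assms in \<open>auto simp: AE_measure_pmf_iff\<close>)
  have e: "0 \<le> measure_pmf.expectation P f" "measure_pmf.expectation P f \<le> 1"
    using integral_mono_AE[OF i, of "\<lambda>_. 1"] assms
    by (auto simp: AE_measure_pmf_iff intro!: integral_nonneg_AE)
  fix c
  have "pmf (bind_pmf P (\<lambda>z. bernoulli_pmf (f z))) c
      = measure_pmf.expectation P (\<lambda>z. if c then f z else 1 - f z)"
    unfolding pmf_bind by (intro integral_cong_AE) (use assms in \<open>auto simp: AE_measure_pmf_iff\<close>)
  also have "\<dots> = pmf (bernoulli_pmf (measure_pmf.expectation P f)) c"
    using e i by (cases c) auto
  finally show "pmf (bind_pmf P (\<lambda>z. bernoulli_pmf (f z))) c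
      = pmf (bernoulli_pmf (measure_pmf.expectation P f)) c" .
qed

text \<open>The parameter is the weight of \<open>0\<close>, the rewarding state. The same family
  serves for transitions, for the law of the state at a given time and for the state component of
  the data.\<close>

definition zero_one_pmf :: "real \<Rightarrow> nat pmf" where
  "zero_one_pmf w = map_pmf (\<lambda>c. if c then 0 else 1) (bernoulli_pmf w)"

lemma bind_zero_one_pmf:
  assumes "\<And>z. z \<in> set_pmf P \<Longrightarrow> 0 \<le> f z \<and> f z \<le> 1"
  shows "bind_pmf P (\<lambda>z. zero_one_pmf (f z)) = zero_one_pmf (measure_pmf.expectation P f)"
  using bind_bernoulli_pmf[of P f, OF assms]
  by (simp add: zero_one_pmf_def map_bind_pmf[symmetric])

lemma set_zero_one_pmf: "set_pmf (zero_one_pmf w) \<subseteq> {0, 1}"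
  by (auto simp: zero_one_pmf_def)

lemma pmf_zero_one_pmf:
  assumes "0 \<le> w" "w \<le> 1"
  shows "pmf (zero_one_pmf w) 0 = w" "pmf (zero_one_pmf w) (Suc 0) = 1 - w"
proof -
  have "(\<lambda>c. if c then 0 else (1::nat)) -` {0} = {True}" "(\<lambda>c. if c then 0 else (1::nat)) -` {Suc 0} = {False}"
    by (auto split: if_splits)
  then show "pmf (zero_one_pmf w) 0 = w" "pmf (zero_one_pmf w) (Suc 0) = 1 - w"
    using assms by (simp_all add: zero_one_pmf_def pmf_map measure_pmf_single)
qed

lemma zero_one_pmf_1: "zero_one_pmf 1 = return_pmf 0"
proof -
  have "bernoulli_pmf 1 = return_pmf True"
    by (rule pmf_eqI) (auto simp: indicator_def)
  then show ?thesis by (simp add: zero_one_pmf_def)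
qed

lemma zero_one_pmf_0: "zero_one_pmf 0 = return_pmf 1"
proof -
  have "bernoulli_pmf 0 = return_pmf False"
    by (rule pmf_eqI) (auto simp: indicator_def)
  then show ?thesis by (simp add: zero_one_pmf_def)
qed

lemma expectation_zero_one_pmf:
  fixes f :: "nat \<Rightarrow> real"
  assumes "0 \<le> w" "w \<le> 1"
  shows "measure_pmf.expectation (zero_one_pmf w) f = w * f 0 + (1 - w) * f 1"
  using assms by (simp add: zero_one_pmf_def algebra_simps)

section \<open>The family of games\<close>

definition stay_prob :: "real \<Rightarrow> real \<Rightarrow> nat \<Rightarrow> nat \<Rightarrow> real" where
  "stay_prob \<gamma> x a b = (if b = 0 then if a = 0 then x else \<gamma> else 1)"

text \<open>From state \<open>0\<close> only \<open>0\<close> and \<open>1\<close> are reachable;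
  the absorbing states from \<open>2\<close> on merely bring their number to
  \<open>S\<close>.\<close>

definition hard_game :: "nat \<Rightarrow> nat \<Rightarrow> nat \<Rightarrow> real \<Rightarrow> real \<Rightarrow> game" where
  "hard_game S A B \<gamma> x =
     \<lparr>n_states = S, n_acts_max = A, n_acts_min = B,
      transition = (\<lambda>s a b. if s = 0 then zero_one_pmf (stay_prob \<gamma> x a b) else return_pmf s),
      reward = (\<lambda>s a b. if s = 0 then 1 else 0),
      discount = \<gamma>\<rparr>"

lemma hard_game_simps [simp]:
  "n_states (hard_game S A B \<gamma> x) = S"
  "n_acts_max (hard_game S A B \<gamma> x) = A"
  "n_acts_min (hard_game S A B \<gamma> x) = B"
  "transition (hard_game S A B \<gamma> x) s a b =
     (if s = 0 then zero_one_pmf (stay_prob \<gamma> x a b) else return_pmf s)"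
  "reward (hard_game S A B \<gamma> x) s a b = (if s = 0 then 1 else 0)"
  "discount (hard_game S A B \<gamma> x) = \<gamma>"
  by (simp_all add: hard_game_def)

text \<open>Probability of remaining in state \<open>0\<close> for one more round. Values and
  occupancies at state \<open>0\<close> depend on the dynamics through this number alone.\<close>

definition mean_stay :: "real \<Rightarrow> real \<Rightarrow> policy \<Rightarrow> policy \<Rightarrow> real" where
  "mean_stay \<gamma> x \<mu> \<nu> =
     measure_pmf.expectation (pair_pmf (\<mu> 0) (\<nu> 0)) (\<lambda>(a, b). stay_prob \<gamma> x a b)"

text \<open>All rows other than \<open>0\<close> are alike, so \<open>1\<close> represents them when
  row \<open>0\<close> is the worse choice.\<close>

definition best_row :: "real \<Rightarrow> real \<Rightarrow> nat" where
  "best_row \<gamma> x = (if \<gamma> \<le> x then 0 else 1)"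

section \<open>State law, values and occupancies for a fixed parameter\<close>

context
  fixes \<gamma> x :: real
  assumes \<gamma>: "0 < \<gamma>" "\<gamma> < 1" and x: "0 \<le> x" "x \<le> 1"
begin

lemma stay_prob_bounds: "0 \<le> stay_prob \<gamma> x a b" "stay_prob \<gamma> x a b \<le> 1"
  using \<gamma> x by (auto simp: stay_prob_def)

lemma integrable_stay_prob: "integrable (measure_pmf p) (\<lambda>(a, b). stay_prob \<gamma> x a b)"
  by (rule measure_pmf.integrable_const_bound[where B = 1]) (use stay_prob_bounds in auto)

lemma mean_stay_bounds: "0 \<le> mean_stay \<gamma> x \<mu> \<nu>" "mean_stay \<gamma> x \<mu> \<nu> \<le> 1"
  unfolding mean_stay_def
  using stay_prob_bounds integral_mono[OF integrable_stay_prob, of _ "\<lambda>_. 1"]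
  by (auto intro!: integral_nonneg_AE split: prod.split)

text \<open>Under stationary policies the state is a two-state chain that survives each round in
  \<open>0\<close> with the same probability and never returns from \<open>1\<close>. Hence the
  weight of \<open>0\<close> is a power, and the actions are drawn afresh given the state.\<close>

lemma visit_pmf_hard_game:
  "visit_pmf (hard_game S A B \<gamma> x) \<mu> \<nu> (return_pmf 0) t =
     bind_pmf (zero_one_pmf (mean_stay \<gamma> x \<mu> \<nu> ^ t)) (play \<mu> \<nu>)"
proof (induction t)
  case 0
  then show ?case by (simp add: zero_one_pmf_1)
next
  case (Suc t)
  let ?\<kappa> = "mean_stay \<gamma> x \<mu> \<nu>"
  let ?T = "\<lambda>(s, a, b). bind_pmf (transition (hard_game S A B \<gamma> x) s a b) (play \<mu> \<nu>)"
  have 0: "bind_pmf (play \<mu> \<nu> 0) ?T = bind_pmf (zero_one_pmf ?\<kappa>) (play \<mu> \<nu>)"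
  proof -
    have "bind_pmf (play \<mu> \<nu> 0) ?T
       = bind_pmf (bind_pmf (pair_pmf (\<mu> 0) (\<nu> 0)) (\<lambda>z. zero_one_pmf (case z of (a, b) \<Rightarrow> stay_prob \<gamma> x a b))) (play \<mu> \<nu>)"
      by (simp add: play_def bind_map_pmf bind_assoc_pmf case_prod_unfold)
    also have "\<dots> = bind_pmf (zero_one_pmf ?\<kappa>) (play \<mu> \<nu>)"
      by (subst bind_zero_one_pmf) (auto simp: mean_stay_def stay_prob_bounds)
    finally show ?thesis .
  qed
  have 1: "bind_pmf (play \<mu> \<nu> 1) ?T = play \<mu> \<nu> 1"
    by (simp add: play_def bind_map_pmf bind_return_pmf case_prod_unfold)
  have "visit_pmf (hard_game S A B \<gamma> x) \<mu> \<nu> (return_pmf 0) (Suc t)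
     = bind_pmf (zero_one_pmf (?\<kappa> ^ t)) (\<lambda>s. bind_pmf (play \<mu> \<nu> s) ?T)"
    by (simp only: visit_pmf.simps Suc bind_assoc_pmf)
  \<comment> \<open>Both states fit one formula, with stay parameter \<open>0\<close> in state
    \<open>1\<close>. The mixture lemma then multiplies the weight of \<open>0\<close> by one more
    factor.\<close>
  also have "\<dots> = bind_pmf (zero_one_pmf (?\<kappa> ^ t))
      (\<lambda>s. bind_pmf (zero_one_pmf (if s = 0 then ?\<kappa> else 0)) (play \<mu> \<nu>))"
    using set_zero_one_pmf 0 1
    by (intro bind_pmf_cong refl) (auto simp: zero_one_pmf_0 bind_return_pmf)
  also have "\<dots> = bind_pmf (zero_one_pmf (?\<kappa> ^ Suc t)) (play \<mu> \<nu>)"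
    using mean_stay_bounds[of \<mu> \<nu>]
    by (subst bind_assoc_pmf[symmetric], subst bind_zero_one_pmf)
       (auto simp: expectation_zero_one_pmf power_le_one mult.commute)
  finally show ?case .
qed

lemma visit_pmf_hard_game_absorbed:
  assumes "0 < s"
  shows "visit_pmf (hard_game S A B \<gamma> x) \<mu> \<nu> (return_pmf s) t = play \<mu> \<nu> s"
  by (induction t) (use assms in \<open>auto simp: bind_return_pmf play_def bind_map_pmf case_prod_unfold\<close>)

lemma V_hard_game_absorbed: "0 < s \<Longrightarrow> V (hard_game S A B \<gamma> x) \<mu> \<nu> s = 0"
  using \<gamma> by (subst V_eq[where R = 1]) (auto simp: visit_pmf_hard_game_absorbed play_def case_prod_unfold)

lemma norm_discount_mean_stay_less_1: "norm (\<gamma> * mean_stay \<gamma> x \<mu> \<nu>) < 1"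
proof -
  have "\<gamma> * mean_stay \<gamma> x \<mu> \<nu> \<le> \<gamma>"
    using mean_stay_bounds[of \<mu> \<nu>] \<gamma> by (simp add: mult_left_le)
  moreover have "0 \<le> \<gamma> * mean_stay \<gamma> x \<mu> \<nu>"
    using mean_stay_bounds[of \<mu> \<nu>] \<gamma> by simp
  ultimately show ?thesis
    using \<gamma> unfolding real_norm_def by linarith
qed

text \<open>The reward is the indicator of state \<open>0\<close>, so the expected reward at time
  \<open>t\<close> is a power of the stay probability and the value a geometric series.\<close>

lemma V_hard_game: "V (hard_game S A B \<gamma> x) \<mu> \<nu> 0 = 1 / (1 - \<gamma> * mean_stay \<gamma> x \<mu> \<nu>)"
proof -
  have E: "measure_pmf.expectation (visit_pmf (hard_game S A B \<gamma> x) \<mu> \<nu> (return_pmf 0) t)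
      (\<lambda>(s', a, b). reward (hard_game S A B \<gamma> x) s' a b) = mean_stay \<gamma> x \<mu> \<nu> ^ t" for t
  proof -
    have "measure_pmf.expectation (visit_pmf (hard_game S A B \<gamma> x) \<mu> \<nu> (return_pmf 0) t)
        (\<lambda>(s', a, b). reward (hard_game S A B \<gamma> x) s' a b)
      = measure_pmf.expectation (map_pmf fst (visit_pmf (hard_game S A B \<gamma> x) \<mu> \<nu> (return_pmf 0) t))
        (\<lambda>s. if s = 0 then 1 else 0)"
      by (simp add: case_prod_unfold)
    also have "map_pmf fst (visit_pmf (hard_game S A B \<gamma> x) \<mu> \<nu> (return_pmf 0) t)
      = zero_one_pmf (mean_stay \<gamma> x \<mu> \<nu> ^ t)"
      by (simp add: visit_pmf_hard_game map_bind_pmf play_def pmf.map_comp o_def case_prod_unfold bind_return_pmf')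
    finally show ?thesis
      using mean_stay_bounds[of \<mu> \<nu>] by (simp add: expectation_zero_one_pmf power_le_one case_prod_unfold)
  qed
  have "V (hard_game S A B \<gamma> x) \<mu> \<nu> 0 = (\<Sum>t. (\<gamma> * mean_stay \<gamma> x \<mu> \<nu>) ^ t)"
    using \<gamma> by (subst V_eq[where R = 1]) (auto simp: E simp flip: power_mult_distrib)
  then show ?thesis
    using suminf_geometric[OF norm_discount_mean_stay_less_1] by simp
qed

lemma occupancy_hard_game:
  "occupancy (hard_game S A B \<gamma> x) \<mu> \<nu> (return_pmf 0) (0, a, b) =
     (1 - \<gamma>) / (1 - \<gamma> * mean_stay \<gamma> x \<mu> \<nu>) * (pmf (\<mu> 0) a * pmf (\<nu> 0) b)"
proof -
  have "pmf (visit_pmf (hard_game S A B \<gamma> x) \<mu> \<nu> (return_pmf 0) t) (0, a, b)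
    = mean_stay \<gamma> x \<mu> \<nu> ^ t * (pmf (\<mu> 0) a * pmf (\<nu> 0) b)" for t
  proof -
    have "pmf (play \<mu> \<nu> s) (0, a, b) = (if s = 0 then pmf (\<mu> 0) a * pmf (\<nu> 0) b else 0)" for s
    proof -
      have "(\<lambda>(a, b). (s, a, b)) -` {(0, a, b)} = (if s = 0 then {(a, b)} else {})"
        by auto
      then show ?thesis
        by (simp add: play_def pmf_map measure_pmf_single pmf_pair)
    qed
    then show ?thesis
      using mean_stay_bounds[of \<mu> \<nu>]
      by (simp add: visit_pmf_hard_game pmf_bind expectation_zero_one_pmf power_le_one)
  qed
  then have "occupancy (hard_game S A B \<gamma> x) \<mu> \<nu> (return_pmf 0) (0, a, b)
     = (1 - \<gamma>) * (\<Sum>t. (\<gamma> * mean_stay \<gamma> x \<mu> \<nu>) ^ t * (pmf (\<mu> 0) a * pmf (\<nu> 0) b))"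
    by (simp add: occupancy_eq power_mult_distrib mult_ac)
  then show ?thesis
    using suminf_geometric[OF norm_discount_mean_stay_less_1] summable_geometric[OF norm_discount_mean_stay_less_1]
    by (subst (asm) suminf_mult2[symmetric]) auto
qed

lemma occupancy_hard_game_unreachable:
  assumes "2 \<le> s"
  shows "occupancy (hard_game S A B \<gamma> x) \<mu> \<nu> (return_pmf 0) (s, a, b) = 0"
proof -
  have "(s, a, b) \<notin> set_pmf (visit_pmf (hard_game S A B \<gamma> x) \<mu> \<nu> (return_pmf 0) t)" for t
    using set_zero_one_pmf assms by (fastforce simp: visit_pmf_hard_game play_def)
  then show ?thesis
    by (simp add: occupancy_eq set_pmf_iff)
qed

section \<open>Dominant column, equilibrium and duality gap\<close>

text \<open>Column \<open>0\<close> has the entry \<open>x\<close> in row \<open>0\<close> and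
  \<gamma> in every other row, so the max-player matters only through the weight put on row
  \<open>0\<close>.\<close>

lemma mean_stay_column0:
  assumes "\<nu> 0 = return_pmf 0"
  shows "mean_stay \<gamma> x \<mu> \<nu> = \<gamma> + pmf (\<mu> 0) 0 * (x - \<gamma>)"
proof -
  have "mean_stay \<gamma> x \<mu> \<nu> = measure_pmf.expectation (\<mu> 0) (\<lambda>a. \<gamma> + indicator {0} a * (x - \<gamma>))"
    by (simp add: mean_stay_def assms pair_return_pmf2 stay_prob_def)
       (auto intro!: Bochner_Integration.integral_cong split: split_indicator)
  also have "\<dots> = \<gamma> + measure_pmf.expectation (\<mu> 0) (indicator {0}) * (x - \<gamma>)"
    by (subst Bochner_Integration.integral_add)
       (auto intro!: measure_pmf.integrable_const_bound[where B = 1] integrable_mult_left)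
  also have "measure_pmf.expectation (\<mu> 0) (indicator {0}) = pmf (\<mu> 0) 0"
    by (simp add: pmf.rep_eq)
  finally show ?thesis .
qed

text \<open>Every row attains its minimum in column \<open>0\<close>, the other entries being
  \<open>1\<close>.\<close>

lemma mean_stay_row_ge:
  assumes "\<mu> 0 = return_pmf a"
  shows "stay_prob \<gamma> x a 0 \<le> mean_stay \<gamma> x \<mu> \<nu>"
proof -
  have "(\<integral>z. stay_prob \<gamma> x a 0 \<partial>measure_pmf (pair_pmf (\<mu> 0) (\<nu> 0))) \<le> mean_stay \<gamma> x \<mu> \<nu>"
    unfolding mean_stay_def using \<gamma> x
    by (intro integral_mono_AE integrable_stay_prob)
       (auto simp: assms AE_measure_pmf_iff stay_prob_def)
  then show ?thesis by simp
qed

lemma stay_prob_best_row: "stay_prob \<gamma> x (best_row \<gamma> x) 0 = max \<gamma> x"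
  by (auto simp: stay_prob_def best_row_def)

lemma mean_stay_column0_le: "\<nu> 0 = return_pmf 0 \<Longrightarrow> mean_stay \<gamma> x \<mu> \<nu> \<le> max \<gamma> x"
  using pmf_le_1[of "\<mu> 0" 0] mult_right_le_one_le[of "x - \<gamma>" "pmf (\<mu> 0) 0"]
    mult_nonneg_nonpos[of "pmf (\<mu> 0) 0" "x - \<gamma>"]
  by (cases "\<gamma> \<le> x") (auto simp: mean_stay_column0 mult.commute)

lemma V_hard_game_mono:
  assumes "mean_stay \<gamma> x \<mu> \<nu> \<le> mean_stay \<gamma> x \<mu>' \<nu>'"
  shows "V (hard_game S A B \<gamma> x) \<mu> \<nu> 0 \<le> V (hard_game S A B \<gamma> x) \<mu>' \<nu>' 0"
  using norm_discount_mean_stay_less_1[of \<mu> \<nu>] norm_discount_mean_stay_less_1[of \<mu>' \<nu>'] assms \<gamma> unfolding V_hard_game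
  by (intro divide_left_mono mult_pos_pos) (auto simp: mult_left_mono abs_less_iff)

text \<open>Column \<open>0\<close> caps the stay probability at \<open>max \<gamma> x\<close>, and
  the best row guarantees at least that much. Since the value at \<open>0\<close> increases with the
  stay probability, this is a saddle point; in all other states every value is
  \<open>0\<close>.\<close>

lemma nash_hard_game:
  assumes SAB: "2 \<le> S" "2 \<le> A" "2 \<le> B"
  shows "nash_equilibrium (hard_game S A B \<gamma> x) (\<lambda>_. return_pmf (best_row \<gamma> x)) (\<lambda>_. return_pmf 0)"
proof -
  let ?\<mu> = "\<lambda>_::nat. return_pmf (best_row \<gamma> x)" and ?\<nu> = "\<lambda>_::nat. return_pmf (0::nat)"
  have eq: "mean_stay \<gamma> x ?\<mu> ?\<nu> = max \<gamma> x"
    by (intro antisym mean_stay_column0_le order_trans[OF _ mean_stay_row_ge[OF refl]])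
       (simp_all add: stay_prob_best_row)
  have "V (hard_game S A B \<gamma> x) \<mu> ?\<nu> s \<le> V (hard_game S A B \<gamma> x) ?\<mu> ?\<nu> s \<and>
      V (hard_game S A B \<gamma> x) ?\<mu> ?\<nu> s \<le> V (hard_game S A B \<gamma> x) ?\<mu> \<nu> s" for \<mu> \<nu> s
    using mean_stay_column0_le[of ?\<nu> \<mu>] mean_stay_row_ge[of ?\<mu> "best_row \<gamma> x" \<nu>]
    by (cases "s = 0") (auto simp: V_hard_game_absorbed eq stay_prob_best_row intro!: V_hard_game_mono)
  then show ?thesis
    using SAB by (auto simp: nash_equilibrium_def policies_def best_row_def)
qed

lemma markov_hard_game:
  assumes SAB: "2 \<le> S" "2 \<le> A" "2 \<le> B"
  shows "markov_game (hard_game S A B \<gamma> x)"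
  using \<gamma> SAB set_zero_one_pmf by (fastforce simp: markov_game_def)

text \<open>Best responses are replaced by explicit ones: the best row against \<nu>, and column
  \<open>0\<close> against \<mu>. The first yields at least the game value whatever \<nu> is, so the
  bound depends on \<mu> alone.\<close>

lemma duality_gap_hard_game_ge:
  assumes SAB: "2 \<le> S" "2 \<le> A" "2 \<le> B" and "\<mu> \<in> policies S A" "\<nu> \<in> policies S B"
  shows "1 / (1 - \<gamma> * max \<gamma> x) - 1 / (1 - \<gamma> * (\<gamma> + pmf (\<mu> 0) 0 * (x - \<gamma>)))
    \<le> duality_gap (hard_game S A B \<gamma> x) (return_pmf 0) (\<mu>, \<nu>)"
proof -
  let ?G = "hard_game S A B \<gamma> x"
  let ?\<mu> = "\<lambda>_::nat. return_pmf (best_row \<gamma> x)" and ?\<nu> = "\<lambda>_::nat. return_pmf (0::nat)"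
  \<comment> \<open>A real-valued \<open>INF\<close> or \<open>SUP\<close> bounds its members only
    if the family is bounded; here all values lie between \<open>0\<close> and
    \<open>1 / (1 - \<gamma>)\<close>.\<close>
  have V0: "0 \<le> V ?G \<mu> \<nu> 0" for \<mu> \<nu>
    using norm_discount_mean_stay_less_1[of \<mu> \<nu>] unfolding V_hard_game by simp
  have V1: "V ?G \<mu> \<nu> 0 \<le> 1 / (1 - \<gamma>)" for \<mu> \<nu>
    using norm_discount_mean_stay_less_1[of \<mu> \<nu>] mean_stay_bounds[of \<mu> \<nu>] \<gamma> unfolding V_hard_game
    by (intro divide_left_mono) (auto simp: mult_left_le)
  have "V ?G \<mu> ?\<nu> 0 = 1 / (1 - \<gamma> * (\<gamma> + pmf (\<mu> 0) 0 * (x - \<gamma>)))"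
    by (simp add: V_hard_game mean_stay_column0)
  moreover have "V_min ?G \<mu> 0 \<le> V ?G \<mu> ?\<nu> 0"
    unfolding V_min_def using SAB
    by (intro cINF_lower bdd_belowI2[where m = 0]) (auto simp: V0 policies_def)
  moreover have "V ?G ?\<mu> \<nu> 0 \<le> V_max ?G \<nu> 0"
    unfolding V_max_def using SAB
    by (intro cSUP_upper bdd_aboveI2[where M = "1 / (1 - \<gamma>)"]) (auto simp: V1 policies_def best_row_def)
  moreover have "1 / (1 - \<gamma> * max \<gamma> x) \<le> V ?G ?\<mu> \<nu> 0"
    using mean_stay_row_ge[of ?\<mu> "best_row \<gamma> x" \<nu>] norm_discount_mean_stay_less_1[of ?\<mu> \<nu>] \<gamma> unfolding V_hard_game
    by (intro divide_left_mono mult_pos_pos) (auto simp: stay_prob_best_row mult_left_mono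
          intro!: order_le_less_trans[OF mult_left_mono[of "max \<gamma> x" "mean_stay \<gamma> x ?\<mu> \<nu>" \<gamma>]])
  ultimately show ?thesis
    by (simp add: duality_gap_def)
qed

end


subsection \<open>Affinity and the two-point method\<close>

text \<open>Bhattacharyya coefficient, as a finite sum: it is the full coefficient as soon as
  \<open>X\<close> contains the support of \<open>p\<close> or of \<open>q\<close>.\<close>

definition affinity :: "'a set \<Rightarrow> 'a pmf \<Rightarrow> 'a pmf \<Rightarrow> real" where
  "affinity X p q = (\<Sum>x\<in>X. sqrt (pmf p x * pmf q x))"

lemma pmf_replicate_pmf_Cons:
  "pmf (replicate_pmf (Suc n) p) (x # xs) = pmf p x * pmf (replicate_pmf n p) xs"
proof -
  have "replicate_pmf (Suc n) p = map_pmf (\<lambda>(x, xs). x # xs) (pair_pmf p (replicate_pmf n p))"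
    by (simp add: pair_pmf_def map_bind_pmf bind_return_pmf)
  moreover have "(\<lambda>(x, xs). x # xs) -` {x # xs} = {(x, xs)}"
    by auto
  ultimately show ?thesis
    by (simp add: pmf_map measure_pmf_single pmf_pair)
qed

text \<open>The mass function of independent draws is a product, so the sum over lists factorises.
  This tensorisation is why affinity is used rather than total variation.\<close>

lemma affinity_replicate_pmf:
  assumes "finite X"
  shows "affinity {xs. set xs \<subseteq> X \<and> length xs = n} (replicate_pmf n p) (replicate_pmf n q) = affinity X p q ^ n"
proof (induction n)
  case 0
  have "{xs. set xs \<subseteq> X \<and> length xs = 0} = {[]}" by auto
  then show ?case by (simp add: affinity_def)
next
  case (Suc n)
  let ?L = "\<lambda>n. {xs. set xs \<subseteq> X \<and> length xs = n}"
  have L: "?L (Suc n) = (\<lambda>(x, xs). x # xs) ` (X \<times> ?L n)"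
    by (auto simp: length_Suc_conv image_iff)
  have inj: "inj_on (\<lambda>(x, xs). x # xs) (X \<times> ?L n)"
    by (auto simp: inj_on_def)
  have "affinity (?L (Suc n)) (replicate_pmf (Suc n) p) (replicate_pmf (Suc n) q)
    = (\<Sum>(x, xs)\<in>X \<times> ?L n. sqrt (pmf p x * pmf q x) * sqrt (pmf (replicate_pmf n p) xs * pmf (replicate_pmf n q) xs))"
    unfolding affinity_def L sum.reindex[OF inj]
    by (intro sum.cong refl)
       (auto simp: pmf_replicate_pmf_Cons real_sqrt_mult mult_ac simp del: replicate_pmf.simps)
  also have "\<dots> = affinity X p q * affinity (?L n) (replicate_pmf n p) (replicate_pmf n q)"
    by (simp add: affinity_def sum_product sum.cartesian_product)
  finally show ?case by (simp add: Suc del: replicate_pmf.simps)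
qed

text \<open>The two joint laws share the first marginal \<open>d\<close>, whose mass comes out of
  the square root as \<open>pmf d x\<close>.\<close>

lemma affinity_bind_map_Pair:
  fixes T T' :: "'a \<Rightarrow> 'b pmf"
  assumes "finite X" "finite Y"
  shows "affinity (X \<times> Y) (bind_pmf d (\<lambda>x. map_pmf (Pair x) (T x))) (bind_pmf d (\<lambda>x. map_pmf (Pair x) (T' x)))
    = (\<Sum>x\<in>X. pmf d x * affinity Y (T x) (T' x))"
proof -
  have pmf: "pmf (bind_pmf d (\<lambda>x. map_pmf (Pair x) (T x))) (x, y) = pmf d x * pmf (T x) y" for x y and T :: "'a \<Rightarrow> 'b pmf"
  proof -
    have "pmf (map_pmf (Pair z) (T z)) (x, y) = indicator {x} z * pmf (T x) y" for z
    proof -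
      have "Pair z -` {(x, y)} = (if z = x then {y} else {})" by auto
      then show ?thesis by (auto simp: pmf_map measure_pmf_single split: split_indicator)
    qed
    then show ?thesis
      by (simp add: pmf_bind) (simp add: pmf.rep_eq)
  qed
  have "affinity (X \<times> Y) (bind_pmf d (\<lambda>x. map_pmf (Pair x) (T x))) (bind_pmf d (\<lambda>x. map_pmf (Pair x) (T' x)))
    = (\<Sum>(x, y)\<in>X \<times> Y. pmf d x * sqrt (pmf (T x) y * pmf (T' x) y))"
    unfolding affinity_def
    by (intro sum.cong refl) (auto simp: pmf real_sqrt_mult)
  also have "\<dots> = (\<Sum>x\<in>X. pmf d x * affinity Y (T x) (T' x))"
    by (simp add: affinity_def sum.cartesian_product[symmetric] sum_distrib_left)
  finally show ?thesis .
qed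

lemma affinity_self: "finite X \<Longrightarrow> set_pmf p \<subseteq> X \<Longrightarrow> affinity X p p = 1"
  by (simp add: affinity_def sum_pmf_eq_1)

section \<open>Le Cam's two-point inequality\<close>

text \<open>Cauchy-Schwarz after writing the product of the two masses as minimum times maximum; the
  maxima sum to at most \<open>2\<close>. The minima sum to one minus the total variation
  distance.\<close>

lemma affinity_le_sum_min:
  assumes "finite X" "set_pmf p \<subseteq> X" "set_pmf q \<subseteq> X"
  shows "(affinity X p q)\<^sup>2 \<le> 2 * (\<Sum>x\<in>X. min (pmf p x) (pmf q x))"
proof -
  have minmax: "min a b * max a b = a * b" for a b :: real
    by (simp add: min_def max_def)
  have "(affinity X p q)\<^sup>2 = (\<Sum>x\<in>X. sqrt (min (pmf p x) (pmf q x)) * sqrt (max (pmf p x) (pmf q x)))\<^sup>2"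
    by (simp add: affinity_def real_sqrt_mult[symmetric] minmax)
  also have "\<dots> \<le> (\<Sum>x\<in>X. (sqrt (min (pmf p x) (pmf q x)))\<^sup>2) * (\<Sum>x\<in>X. (sqrt (max (pmf p x) (pmf q x)))\<^sup>2)"
    by (rule Cauchy_Schwarz_ineq_sum)
  also have "\<dots> = (\<Sum>x\<in>X. min (pmf p x) (pmf q x)) * (\<Sum>x\<in>X. max (pmf p x) (pmf q x))"
    by (simp add: min_def max_def)
  also have "\<dots> \<le> (\<Sum>x\<in>X. min (pmf p x) (pmf q x)) * (\<Sum>x\<in>X. pmf p x + pmf q x)"
    by (intro mult_left_mono sum_mono sum_nonneg) auto
  also have "(\<Sum>x\<in>X. pmf p x + pmf q x) = 2"
    using assms by (simp add: sum.distrib sum_pmf_eq_1)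
  finally show ?thesis by simp
qed

text \<open>Here \<open>f\<close> and \<open>g\<close> are the losses of one estimator under two
  hypotheses. On the common mass \<open>min (pmf p x) (pmf q x)\<close> both losses are incurred, in
  total at least \<open>c\<close>.\<close>

lemma two_point_bound:
  fixes f g :: "'a \<Rightarrow> real"
  assumes X: "finite X" "set_pmf p \<subseteq> X" "set_pmf q \<subseteq> X"
    and fg: "\<And>x. x \<in> X \<Longrightarrow> 0 \<le> f x" "\<And>x. x \<in> X \<Longrightarrow> 0 \<le> g x" "\<And>x. x \<in> X \<Longrightarrow> c \<le> f x + g x" and c: "0 \<le> c"
  shows "c / 2 * (affinity X p q)\<^sup>2 \<le> measure_pmf.expectation p f + measure_pmf.expectation q g"
proof -
  have "c / 2 * (affinity X p q)\<^sup>2 \<le> c * (\<Sum>x\<in>X. min (pmf p x) (pmf q x))"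
    using mult_left_mono[OF affinity_le_sum_min[OF X] c] by simp
  also have "\<dots> \<le> (\<Sum>x\<in>X. f x * pmf p x + g x * pmf q x)"
    unfolding sum_distrib_left
  proof (rule sum_mono)
    fix x assume x: "x \<in> X"
    let ?m = "min (pmf p x) (pmf q x)"
    have "c * ?m \<le> (f x + g x) * ?m"
      using fg(3)[OF x] by (intro mult_right_mono) auto
    also have "\<dots> \<le> f x * pmf p x + g x * pmf q x"
      unfolding distrib_right using fg(1,2)[OF x] by (intro add_mono mult_left_mono) auto
    finally show "c * ?m \<le> f x * pmf p x + g x * pmf q x" .
  qed
  also have "\<dots> = measure_pmf.expectation p f + measure_pmf.expectation q g"
  proof -
    have "measure_pmf.expectation r h = (\<Sum>x\<in>X. h x * pmf r x)" if "set_pmf r \<subseteq> X" for r and h :: "'a \<Rightarrow> real"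
      by (rule integral_measure_pmf_real[OF X(1)]) (use that in auto)
    with X show ?thesis by (simp add: sum.distrib)
  qed
  finally show ?thesis .
qed

section \<open>Affinity of two perturbed two-point laws\<close>

lemma sqrt_ge_self: "0 \<le> u \<Longrightarrow> u \<le> 1 \<Longrightarrow> u \<le> sqrt (u::real)"
  by (rule real_le_rsqrt) (simp add: power2_eq_square mult_left_le)

text \<open>Factor out \<open>v\<close> and use that the square root dominates the identity on the
  unit interval.\<close>

lemma sqrt_shift_ge:
  fixes v \<delta> :: real
  assumes "0 < v" "\<bar>\<delta>\<bar> \<le> v"
  shows "v - \<delta>\<^sup>2 / v \<le> sqrt ((v + \<delta>) * (v - \<delta>))"
proof -
  have "\<delta>\<^sup>2 \<le> v\<^sup>2" using assms by (simp add: abs_le_square_iff[symmetric])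
  then have "1 - \<delta>\<^sup>2 / v\<^sup>2 \<le> sqrt (1 - \<delta>\<^sup>2 / v\<^sup>2)"
    using assms by (intro sqrt_ge_self) (auto simp: field_simps)
  then have "v * (1 - \<delta>\<^sup>2 / v\<^sup>2) \<le> v * sqrt (1 - \<delta>\<^sup>2 / v\<^sup>2)"
    using assms by (intro mult_left_mono) auto
  also have "v * sqrt (1 - \<delta>\<^sup>2 / v\<^sup>2) = sqrt (v\<^sup>2 * (1 - \<delta>\<^sup>2 / v\<^sup>2))"
    using assms by (simp add: real_sqrt_mult)
  also have "v\<^sup>2 * (1 - \<delta>\<^sup>2 / v\<^sup>2) = (v + \<delta>) * (v - \<delta>)"
    using assms by (simp add: field_simps power2_eq_square)
  also have "v * (1 - \<delta>\<^sup>2 / v\<^sup>2) = v - \<delta>\<^sup>2 / v"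
    using assms by (simp add: field_simps power2_eq_square)
  finally show ?thesis .
qed

text \<open>The previous bound is applied at \<gamma> and at \<open>1 - \<gamma>\<close>; the two
  losses add up because \<open>1 / \<gamma> + 1 / (1 - \<gamma>) = 1 / (\<gamma> * (1 -
  \<gamma>))\<close>.\<close>

lemma affinity_zero_one_pmf_ge:
  assumes "0 < \<gamma>" "\<gamma> < 1" "\<bar>\<delta>\<bar> \<le> \<gamma>" "\<bar>\<delta>\<bar> \<le> 1 - \<gamma>" "2 \<le> S"
  shows "1 - \<delta>\<^sup>2 / (\<gamma> * (1 - \<gamma>)) \<le> affinity {..<S} (zero_one_pmf (\<gamma> + \<delta>)) (zero_one_pmf (\<gamma> - \<delta>))"
proof -
  let ?p = "zero_one_pmf (\<gamma> + \<delta>)" and ?q = "zero_one_pmf (\<gamma> - \<delta>)"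
  have b: "0 \<le> \<gamma> + \<delta>" "\<gamma> + \<delta> \<le> 1" "0 \<le> \<gamma> - \<delta>" "\<gamma> - \<delta> \<le> 1"
    using assms by auto
  have "1 - \<delta>\<^sup>2 / (\<gamma> * (1 - \<gamma>)) = (\<gamma> - \<delta>\<^sup>2 / \<gamma>) + ((1 - \<gamma>) - \<delta>\<^sup>2 / (1 - \<gamma>))"
    using assms by (simp add: field_simps)
  also have "\<dots> \<le> sqrt ((\<gamma> + \<delta>) * (\<gamma> - \<delta>)) + sqrt ((1 - \<gamma> + \<delta>) * (1 - \<gamma> - \<delta>))"
    using assms by (intro add_mono sqrt_shift_ge) auto
  also have "\<dots> = (\<Sum>s\<in>{0, Suc 0}. sqrt (pmf ?p s * pmf ?q s))"
    using b by (simp add: pmf_zero_one_pmf algebra_simps)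
  also have "\<dots> \<le> affinity {..<S} ?p ?q"
    unfolding affinity_def using assms by (intro sum_mono2) auto
  finally show ?thesis .
qed


subsection \<open>The data distribution and the lower bound\<close>

text \<open>Each triple in state \<open>0\<close> gets mass \<open>1 / K\<close>. The remaining
  mass, at least one half when \<open>K\<close> is at least \<open>2 * A * B\<close>, lies on state
  \<open>1\<close> and covers each of its triples with at least \<open>1 / K\<close>.\<close>

definition hard_data :: "nat \<Rightarrow> nat \<Rightarrow> real \<Rightarrow> (nat \<times> nat \<times> nat) pmf" where
  "hard_data A B K =
     pair_pmf (zero_one_pmf (real A * real B / K)) (pmf_of_set ({..<A} \<times> {..<B}))"

context
  fixes A B :: nat and K :: real
  assumes A: "2 \<le> A" and B: "2 \<le> B" and K: "2 * real A * real B \<le> K"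
begin

lemma hard_data_weight_pos: "0 < K"
  by (rule less_le_trans[OF _ K]) (use A B in simp)

lemma finite_nonempty_actions: "finite ({..<A} \<times> {..<B})" "{..<A} \<times> {..<B} \<noteq> {}"
proof -
  have "(0, 0) \<in> {..<A} \<times> {..<B}" using A B by auto
  then show "{..<A} \<times> {..<B} \<noteq> {}" by blast
qed simp

lemma hard_data_fraction_bounds: "0 \<le> real A * real B / K" "real A * real B / K \<le> 1 / 2"
  using K hard_data_weight_pos by (auto simp: field_simps)

lemma set_hard_data: "set_pmf (hard_data A B K) \<subseteq> {0, 1} \<times> {..<A} \<times> {..<B}"
  using set_zero_one_pmf finite_nonempty_actions by (auto simp: hard_data_def set_pmf_of_set)

lemma pmf_hard_data_0: "a < A \<Longrightarrow> b < B \<Longrightarrow> pmf (hard_data A B K) (0, a, b) = 1 / K"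
  using hard_data_fraction_bounds hard_data_weight_pos finite_nonempty_actions A B
  by (simp add: hard_data_def pmf_pair pmf_zero_one_pmf)

lemma pmf_hard_data_1: "a < A \<Longrightarrow> b < B \<Longrightarrow> 1 / K \<le> pmf (hard_data A B K) (Suc 0, a, b)"
  using hard_data_fraction_bounds hard_data_weight_pos finite_nonempty_actions A B K
  by (simp add: hard_data_def pmf_pair pmf_zero_one_pmf field_simps)

end

text \<open>The clipped numerator is at most \<open>1 / n\<close> and the data mass of a reachable
  triple at least \<open>1 / K\<close>, so no ratio exceeds \<open>K / n = C\<close>. Equality holds
  at the triple played in equilibrium in state \<open>0\<close>, where the clipping is
  active.\<close>

lemma hard_instance_in_MG:
  assumes \<gamma>: "2 / 3 \<le> \<gamma>" "\<gamma> < 1" and x: "0 \<le> x" "x \<le> 1"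
    and SAB: "2 \<le> S" "2 \<le> A" "2 \<le> B"
    and C: "2 * real A * real B / (real S * (real A + real B)) \<le> C"
  shows "(hard_game S A B \<gamma> x, return_pmf 0, hard_data A B (real S * (real A + real B) * C)) \<in> MG S A B \<gamma> C"
proof -
  define K where "K = real S * (real A + real B) * C"
  let ?G = "hard_game S A B \<gamma> x" and ?d = "hard_data A B K"
  let ?\<mu> = "\<lambda>_::nat. return_pmf (best_row \<gamma> x)" and ?\<nu> = "\<lambda>_::nat. return_pmf (0::nat)"
  have \<gamma>': "0 < \<gamma>" using \<gamma> by simp
  define n where "n = real S * (real A + real B)"
  have "2 * 4 \<le> n" unfolding n_def using SAB by (intro mult_mono) auto
  then have n: "8 \<le> n" by simp
  have K: "2 * real A * real B \<le> K"
    using C n unfolding K_def n_def[symmetric] by (simp add: field_simps)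
  have Kpos: "0 < K" using hard_data_weight_pos[OF SAB(2,3) K] .
  have Cpos: "0 < C" using Kpos n unfolding K_def n_def[symmetric] by (simp add: zero_less_mult_iff)
  have Kn: "1 / n / (1 / K) = C" using n unfolding K_def n_def[symmetric] by simp
  have ratio_le: "clipped_ratio ?G (return_pmf 0) ?d \<mu> \<nu> z \<le> ennreal C" if "z \<in> triples ?G" for \<mu> \<nu> z
  proof -
    obtain s a b where z: "z = (s, a, b)" by (cases z)
    show ?thesis
    proof (cases "2 \<le> s")
      case True
      then have "occupancy ?G \<mu> \<nu> (return_pmf 0) z = 0"
        using occupancy_hard_game_unreachable[OF \<gamma>' \<gamma>(2) x] z by simp
      \<comment> \<open>The data give these states no mass either; the ratio is
        \<open>0 / 0 = 0\<close>.\<close>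
      then show ?thesis using n by (simp add: clipped_ratio_def n_def[symmetric])
    next
      case False
      have "s = 0 \<or> s = 1" using False by auto
      then have d: "1 / K \<le> pmf ?d z"
        using pmf_hard_data_0[OF SAB(2,3) K] pmf_hard_data_1[OF SAB(2,3) K] that z
        by (auto simp: triples_def)
      have dpos: "0 < pmf ?d z" by (rule less_le_trans[OF _ d]) (use Kpos in simp)
      have "clipped_ratio ?G (return_pmf 0) ?d \<mu> \<nu> z \<le> ennreal (1 / n) / ennreal (pmf ?d z)"
        unfolding clipped_ratio_def by (intro divide_right_mono_ennreal ennreal_leI) (simp add: n_def)
      also have "\<dots> = ennreal (1 / n / pmf ?d z)"
        using dpos n by (subst divide_ennreal) auto
      also have "\<dots> \<le> ennreal (1 / n / (1 / K))"
        using d n Kpos by (intro ennreal_leI divide_left_mono mult_pos_pos dpos) auto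
      finally show ?thesis by (simp only: Kn)
    qed
  qed
  have ratio_eq: "clipped_ratio ?G (return_pmf 0) ?d ?\<mu> ?\<nu> (0, best_row \<gamma> x, 0) = ennreal C"
  proof -
    let ?\<kappa> = "mean_stay \<gamma> x ?\<mu> ?\<nu>"
    \<comment> \<open>A stay probability of at least \<gamma> makes the occupancy at least one half,
      which is above the clipping level \<open>1 / n\<close>.\<close>
    have "max \<gamma> x \<le> ?\<kappa>"
      using mean_stay_row_ge[OF \<gamma>' \<gamma>(2) x, of ?\<mu> "best_row \<gamma> x" ?\<nu>]
        stay_prob_best_row[OF \<gamma>' \<gamma>(2) x] by simp
    then have "\<gamma> * \<gamma> \<le> \<gamma> * ?\<kappa>" using \<gamma>' by simp
    moreover have "\<gamma> * ?\<kappa> \<le> \<gamma>"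
      using mean_stay_bounds[OF \<gamma>' \<gamma>(2) x, of ?\<mu> ?\<nu>] \<gamma>' by (simp add: mult_left_le)
    moreover have "1 - \<gamma> * \<gamma> \<le> 2 * (1 - \<gamma>)"
    proof -
      have "0 \<le> (1 - \<gamma>) * (1 - \<gamma>)" by simp
      then show ?thesis by (simp add: algebra_simps)
    qed
    ultimately have "0 < 1 - \<gamma> * ?\<kappa>" "1 - \<gamma> * ?\<kappa> \<le> 2 * (1 - \<gamma>)"
      using \<gamma>(2) by linarith+
    then have "1 / 2 \<le> (1 - \<gamma>) / (1 - \<gamma> * ?\<kappa>)"
      by (simp add: le_divide_eq)
    moreover have "1 / n \<le> 1 / 2"
      using n by (simp add: field_simps)
    ultimately have "1 / n \<le> (1 - \<gamma>) / (1 - \<gamma> * ?\<kappa>)"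
      by (rule order_trans[rotated])
    then have "1 / n \<le> occupancy ?G ?\<mu> ?\<nu> (return_pmf 0) (0, best_row \<gamma> x, 0)"
      by (simp add: occupancy_hard_game[OF \<gamma>' \<gamma>(2) x])
    then have "clipped_ratio ?G (return_pmf 0) ?d ?\<mu> ?\<nu> (0, best_row \<gamma> x, 0) = ennreal (1 / n) / ennreal (1 / K)"
      using pmf_hard_data_0[OF SAB(2,3) K, of "best_row \<gamma> x" 0] SAB
      by (simp add: clipped_ratio_def n_def[symmetric] best_row_def min_absorb2)
    also have "\<dots> = ennreal (1 / n / (1 / K))"
      using n Kpos by (subst divide_ennreal) auto
    finally show ?thesis by (simp only: Kn)
  qed
  have nash: "nash_equilibrium ?G ?\<mu> ?\<nu>"
    by (rule nash_hard_game[OF \<gamma>' \<gamma>(2) x SAB])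
  have "clipped_concentrability ?G (return_pmf 0) ?d ?\<mu> ?\<nu> = ennreal C"
  proof (rule antisym)
    show "clipped_concentrability ?G (return_pmf 0) ?d ?\<mu> ?\<nu> \<le> ennreal C"
      unfolding clipped_concentrability_def by (intro max.boundedI SUP_least ratio_le)
    have "(0, best_row \<gamma> x, 0) \<in> triples ?G"
      using SAB by (auto simp: triples_def best_row_def)
    moreover have "?\<mu> \<in> max_policies ?G"
      using nash by (simp add: nash_equilibrium_def)
    ultimately have "ennreal C \<le> (SUP \<mu>\<in>max_policies ?G. SUP z\<in>triples ?G. clipped_ratio ?G (return_pmf 0) ?d \<mu> ?\<nu> z)"
      by (intro SUP_upper2[of ?\<mu>] SUP_upper2[of "(0, best_row \<gamma> x, 0)"]) (auto simp: ratio_eq)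
    then show "ennreal C \<le> clipped_concentrability ?G (return_pmf 0) ?d ?\<mu> ?\<nu>"
      by (simp add: clipped_concentrability_def le_max_iff_disj)
  qed
  then show ?thesis
    unfolding MG_def K_def[symmetric]
    using nash markov_hard_game[OF \<gamma>' \<gamma>(2) x SAB] set_hard_data[OF SAB(2,3) K] SAB
    by (fastforce simp: triples_def)
qed

section \<open>Affinity of one sample from the two games\<close>

lemma affinity_map_pmf_inj:
  assumes "inj f"
  shows "affinity (f ` X) (map_pmf f p) (map_pmf f q) = affinity X p q"
  using assms inj_on_subset[OF assms, of X]
  by (simp add: affinity_def sum.reindex pmf_map_inj')

text \<open>Reassociates a triple paired with its successor into the quadruple of the dataset; being
  injective, it preserves affinity.\<close>

definition flatten_transition :: "(nat \<times> nat \<times> nat) \<times> nat \<Rightarrow> nat \<times> nat \<times> nat \<times> nat" where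
  "flatten_transition = (\<lambda>((s, a, b), s'). (s, a, b, s'))"

lemma inj_flatten_transition: "inj flatten_transition"
  by (auto simp: inj_on_def flatten_transition_def)

lemma sample_eq_map_pmf:
  "sample G d = map_pmf flatten_transition
     (bind_pmf d (\<lambda>z. map_pmf (Pair z) (case z of (s, a, b) \<Rightarrow> transition G s a b)))"
  by (simp add: sample_def map_bind_pmf pmf.map_comp o_def flatten_transition_def case_prod_unfold)

lemma set_pmf_sample:
  assumes "markov_game G" "set_pmf d \<subseteq> triples G"
  shows "set_pmf (sample G d) \<subseteq> flatten_transition ` (triples G \<times> {..<n_states G})"
proof -
  have "set_pmf (transition G s a b) \<subseteq> {..<n_states G}" if "(s, a, b) \<in> set_pmf d" for s a b
    using assms that unfolding markov_game_def triples_def by blast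
  with assms(2) show ?thesis
    unfolding sample_eq_map_pmf set_map_pmf by (intro image_mono) (auto; blast)
qed

text \<open>The games differ only in the transition from \<open>(0, 0, 0)\<close>. All other triples
  contribute affinity \<open>1\<close>, so the loss is weighted by the data mass of that single
  triple.\<close>

lemma affinity_sample_ge:
  assumes \<gamma>: "0 < \<gamma>" "\<gamma> < 1" and \<delta>: "\<bar>\<delta>\<bar> \<le> \<gamma>" "\<bar>\<delta>\<bar> \<le> 1 - \<gamma>"
    and SAB: "2 \<le> S" "2 \<le> A" "2 \<le> B"
    and d: "set_pmf d \<subseteq> {..<S} \<times> {..<A} \<times> {..<B}"
  shows "1 - \<delta>\<^sup>2 / (\<gamma> * (1 - \<gamma>)) * pmf d (0, 0, 0)
    \<le> affinity (flatten_transition ` (({..<S} \<times> {..<A} \<times> {..<B}) \<times> {..<S}))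
         (sample (hard_game S A B \<gamma> (\<gamma> + \<delta>)) d) (sample (hard_game S A B \<gamma> (\<gamma> - \<delta>)) d)"
proof -
  let ?Z = "{..<S} \<times> {..<A} \<times> {..<B}"
  let ?h = "\<delta>\<^sup>2 / (\<gamma> * (1 - \<gamma>))"
  define T where "T x z = (case z of (s, a, b) \<Rightarrow> transition (hard_game S A B \<gamma> x) s a b)" for x and z :: "nat \<times> nat \<times> nat"
  have fin: "finite ?Z" by simp
  have T: "1 - (if z = (0, 0, 0) then ?h else 0) \<le> affinity {..<S} (T (\<gamma> + \<delta>) z) (T (\<gamma> - \<delta>) z)"
    if "z \<in> ?Z" for z
  proof (cases "z = (0, 0, 0)")
    case True
    then show ?thesis
      using affinity_zero_one_pmf_ge[OF \<gamma> \<delta> SAB(1)] by (simp add: T_def stay_prob_def)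
  next
    case False
    have "T (\<gamma> + \<delta>) z = T (\<gamma> - \<delta>) z"
      using False by (auto simp: T_def stay_prob_def split: prod.split)
    moreover have "set_pmf (T (\<gamma> - \<delta>) z) \<subseteq> {..<S}"
    proof (cases z)
      case (fields s a b)
      have "{0, 1} \<subseteq> {..<S}" using SAB by auto
      then have "set_pmf (zero_one_pmf w) \<subseteq> {..<S}" for w
        using set_zero_one_pmf by (rule order_trans[rotated])
      then show ?thesis using that by (simp add: T_def fields)
    qed
    ultimately show ?thesis using False by (simp add: affinity_self)
  qed
  have "1 - ?h * pmf d (0, 0, 0) = (\<Sum>z\<in>?Z. pmf d z * (1 - (if z = (0, 0, 0) then ?h else 0)))"
  proof -
    have "(\<Sum>z\<in>?Z. pmf d z * (1 - (if z = (0, 0, 0) then ?h else 0)))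
      = (\<Sum>z\<in>?Z. pmf d z) - (\<Sum>z\<in>?Z. if z = (0, 0, 0) then ?h * pmf d z else 0)"
      unfolding sum_subtractf[symmetric] by (intro sum.cong) (auto simp: algebra_simps)
    also have "\<dots> = 1 - ?h * pmf d (0, 0, 0)"
      using SAB d by (simp add: sum.delta[OF fin] sum_pmf_eq_1[OF fin])
    finally show ?thesis by (rule sym)
  qed
  also have "\<dots> \<le> (\<Sum>z\<in>?Z. pmf d z * affinity {..<S} (T (\<gamma> + \<delta>) z) (T (\<gamma> - \<delta>) z))"
    by (intro sum_mono mult_left_mono T) auto
  also have "\<dots> = affinity (flatten_transition ` (?Z \<times> {..<S}))
         (sample (hard_game S A B \<gamma> (\<gamma> + \<delta>)) d) (sample (hard_game S A B \<gamma> (\<gamma> - \<delta>)) d)"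
    unfolding sample_eq_map_pmf affinity_map_pmf_inj[OF inj_flatten_transition]
      T_def[symmetric] by (rule affinity_bind_map_Pair[symmetric]) auto
  finally show ?thesis .
qed

section \<open>Loss of a policy pair in the two games\<close>

lemma inverse_diff_ge:
  fixes u v w :: real
  assumes "0 < u" "u \<le> v" "v \<le> w"
  shows "(v - u) / w\<^sup>2 \<le> 1 / u - 1 / v"
proof -
  have "(v - u) / w\<^sup>2 \<le> (v - u) / (u * v)"
    unfolding power2_eq_square using assms by (intro divide_left_mono mult_mono mult_pos_pos) auto
  also have "\<dots> = 1 / u - 1 / v"
    using assms by (simp add: field_simps)
  finally show ?thesis .
qed

text \<open>The loss is caused by the weight off row \<open>0\<close> in the first game and by the
  weight on row \<open>0\<close> in the second, so the two bounds have a sum that is the same for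
  every policy pair.\<close>

lemma duality_gap_hard_game_lower:
  fixes \<gamma> \<delta> :: real
  assumes \<gamma>: "2 / 3 \<le> \<gamma>" "\<gamma> < 1" and \<delta>: "0 \<le> \<delta>" "\<delta> \<le> (1 - \<gamma>) / 2"
    and SAB: "2 \<le> S" "2 \<le> A" "2 \<le> B" and pol: "fst \<pi> \<in> policies S A" "snd \<pi> \<in> policies S B"
  shows "2 / 27 * \<delta> / (1 - \<gamma>)\<^sup>2 * (1 - pmf (fst \<pi> 0) 0)
      \<le> duality_gap (hard_game S A B \<gamma> (\<gamma> + \<delta>)) (return_pmf 0) \<pi>"
    and "2 / 27 * \<delta> / (1 - \<gamma>)\<^sup>2 * pmf (fst \<pi> 0) 0
      \<le> duality_gap (hard_game S A B \<gamma> (\<gamma> - \<delta>)) (return_pmf 0) \<pi>"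
proof -
  let ?q = "pmf (fst \<pi> 0) 0"
  have \<gamma>': "0 < \<gamma>" using \<gamma> by simp
  have q: "0 \<le> ?q" "?q \<le> 1" by (auto simp: pmf_le_1)
  have sq: "(1 - \<gamma>) \<le> 1 - \<gamma> * \<gamma>" "1 - \<gamma> * \<gamma> \<le> 2 * (1 - \<gamma>)"
  proof -
    have "0 \<le> (1 - \<gamma>) * (1 - \<gamma>)" "\<gamma> * \<gamma> \<le> \<gamma>" using \<gamma> by (simp_all add: mult_left_le)
    then show "(1 - \<gamma>) \<le> 1 - \<gamma> * \<gamma>" "1 - \<gamma> * \<gamma> \<le> 2 * (1 - \<gamma>)" by (simp_all add: algebra_simps)
  qed
  have gd: "2 / 3 * (\<delta> * r) \<le> \<gamma> * \<delta> * r" "\<gamma> * \<delta> * r \<le> (1 - \<gamma>) / 2" "0 \<le> \<gamma> * \<delta> * r" if "0 \<le> r" "r \<le> 1" for r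
  proof -
    show "2 / 3 * (\<delta> * r) \<le> \<gamma> * \<delta> * r"
      using mult_right_mono[OF \<gamma>(1), of "\<delta> * r"] \<delta> that by (simp add: mult.assoc)
    have "\<gamma> * \<delta> * r \<le> 1 * \<delta> * 1"
      using \<gamma> \<delta> that by (intro mult_mono) auto
    then show "\<gamma> * \<delta> * r \<le> (1 - \<gamma>) / 2" using \<delta> by simp
    show "0 \<le> \<gamma> * \<delta> * r" using \<gamma> \<delta> that by simp
  qed
  \<comment> \<open>The constant is \<open>(2 / 3) / 3\<^sup>2\<close>: the numerator comes from
    \<gamma> being at least \<open>2 / 3\<close>, the square from denominators of at most
    \<open>3 * (1 - \<gamma>)\<close>.\<close>
  have step: "2 / 27 * \<delta> / (1 - \<gamma>)\<^sup>2 * r \<le> 1 / u - 1 / v"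
    if "0 < u" "v - u = \<gamma> * \<delta> * r" "v \<le> 3 * (1 - \<gamma>)" "0 \<le> r" "r \<le> 1" for u v r
  proof -
    have "(3 * (1 - \<gamma>))\<^sup>2 = 9 * (1 - \<gamma>)\<^sup>2"
      by (simp add: power2_eq_square algebra_simps)
    then have "2 / 27 * \<delta> / (1 - \<gamma>)\<^sup>2 * r = 2 / 3 * (\<delta> * r) / (3 * (1 - \<gamma>))\<^sup>2"
      by simp
    also have "\<dots> \<le> (v - u) / (3 * (1 - \<gamma>))\<^sup>2"
      using gd[OF that(4,5)] that(2) by (intro divide_right_mono) auto
    also have "\<dots> \<le> 1 / u - 1 / v"
      using that gd(3)[OF that(4,5)] by (intro inverse_diff_ge) auto
    finally show ?thesis .
  qed
  have "2 / 27 * \<delta> / (1 - \<gamma>)\<^sup>2 * (1 - ?q)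
      \<le> 1 / (1 - \<gamma> * \<gamma> - \<gamma> * \<delta>) - 1 / (1 - \<gamma> * \<gamma> - \<gamma> * \<delta> * ?q)"
  proof (rule step)
    \<comment> \<open>The smaller denominator stays positive, since
      \<open>1 - \<gamma> * \<gamma>\<close> is at least \<open>1 - \<gamma>\<close>.\<close>
    have "\<gamma> * \<delta> \<le> (1 - \<gamma>) / 2"
      using gd(2)[OF zero_le_one order_refl] by simp
    then show "0 < 1 - \<gamma> * \<gamma> - \<gamma> * \<delta>"
      using sq(1) \<gamma>(2) by argo
    show "1 - \<gamma> * \<gamma> - \<gamma> * \<delta> * ?q \<le> 3 * (1 - \<gamma>)"
      using sq(2) gd(3)[OF q] \<gamma>(2) by argo
  qed (use q in \<open>simp_all add: algebra_simps\<close>)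
  also have "\<dots> = 1 / (1 - \<gamma> * max \<gamma> (\<gamma> + \<delta>)) - 1 / (1 - \<gamma> * (\<gamma> + ?q * (\<gamma> + \<delta> - \<gamma>)))"
    using \<delta> by (simp add: max_def algebra_simps)
  also have "\<dots> \<le> duality_gap (hard_game S A B \<gamma> (\<gamma> + \<delta>)) (return_pmf 0) \<pi>"
    using duality_gap_hard_game_ge[OF \<gamma>' \<gamma>(2) _ _ SAB pol, of "\<gamma> + \<delta>"] \<gamma> \<delta> by simp
  finally show "2 / 27 * \<delta> / (1 - \<gamma>)\<^sup>2 * (1 - ?q)
      \<le> duality_gap (hard_game S A B \<gamma> (\<gamma> + \<delta>)) (return_pmf 0) \<pi>" .
  have "2 / 27 * \<delta> / (1 - \<gamma>)\<^sup>2 * ?q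
      \<le> 1 / (1 - \<gamma> * \<gamma>) - 1 / (1 - \<gamma> * \<gamma> + \<gamma> * \<delta> * ?q)"
  proof (rule step)
    show "0 < 1 - \<gamma> * \<gamma>"
      using sq(1) \<gamma>(2) by argo
    show "1 - \<gamma> * \<gamma> + \<gamma> * \<delta> * ?q \<le> 3 * (1 - \<gamma>)"
      using sq(2) gd(2)[OF q] \<gamma>(2) by argo
  qed (use q in simp_all)
  also have "\<dots> = 1 / (1 - \<gamma> * max \<gamma> (\<gamma> - \<delta>)) - 1 / (1 - \<gamma> * (\<gamma> + ?q * (\<gamma> - \<delta> - \<gamma>)))"
    using \<delta> by (simp add: max_def algebra_simps)
  also have "\<dots> \<le> duality_gap (hard_game S A B \<gamma> (\<gamma> - \<delta>)) (return_pmf 0) \<pi>"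
    using duality_gap_hard_game_ge[OF \<gamma>' \<gamma>(2) _ _ SAB pol, of "\<gamma> - \<delta>"] \<gamma> \<delta> by simp
  finally show "2 / 27 * \<delta> / (1 - \<gamma>)\<^sup>2 * ?q
      \<le> duality_gap (hard_game S A B \<gamma> (\<gamma> - \<delta>)) (return_pmf 0) \<pi>" .
qed

section \<open>The minimax bound\<close>

text \<open>Form without logarithms and with explicit constants: the ranges of \<epsilon> and
  \<open>N\<close> in the theorem lie inside these because \<open>ln (A + B)\<close> is at least
  \<open>1\<close>.\<close>

lemma minimax_lower_bound:
  fixes \<gamma> C \<epsilon> :: real and S A B N :: nat
  assumes SAB: "2 \<le> S" "2 \<le> A" "2 \<le> B" and \<gamma>: "2 / 3 \<le> \<gamma>" "\<gamma> < 1"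
    and C: "2 * real A * real B / (real S * (real A + real B)) \<le> C"
    and \<epsilon>: "0 < \<epsilon>" "432 * (1 - \<gamma>) * \<epsilon> \<le> 1"
    and N: "139968 * ((1 - \<gamma>) ^ 3 * \<epsilon>\<^sup>2) * real N \<le> real S * (real A + real B) * C"
    and est: "est \<in> estimators S A B"
  shows "\<exists>T\<in>MG S A B \<gamma> C. \<epsilon> \<le> expected_gap N est T"
proof -
  \<comment> \<open>The factor satisfies \<open>2 / 27 * 216 = 16\<close>, so the losses in the two
    games add up to \<open>16 * \<epsilon>\<close>; the bound \<open>432 = 2 * 216\<close> on
    \<epsilon> keeps \<delta> below \<open>(1 - \<gamma>) / 2\<close>.\<close>
  define \<delta> where "\<delta> = 216 * (1 - \<gamma>)\<^sup>2 * \<epsilon>"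
  define K where "K = real S * (real A + real B) * C"
  define d where "d = hard_data A B K"
  let ?G1 = "hard_game S A B \<gamma> (\<gamma> + \<delta>)" and ?G2 = "hard_game S A B \<gamma> (\<gamma> - \<delta>)"
  have \<delta>0: "0 \<le> \<delta>" using \<epsilon> by (simp add: \<delta>_def)
  have "\<delta> = (1 - \<gamma>) / 2 * (432 * (1 - \<gamma>) * \<epsilon>)"
    by (simp add: \<delta>_def power2_eq_square)
  also have "\<dots> \<le> (1 - \<gamma>) / 2 * 1"
    using \<gamma> by (intro mult_left_mono \<epsilon>(2)) simp
  finally have \<delta>1: "\<delta> \<le> (1 - \<gamma>) / 2" by simp
  have "0 < real S * (real A + real B)" using SAB by simp
  then have K: "2 * real A * real B \<le> K"
    using C unfolding K_def by (simp add: pos_divide_le_eq mult_ac)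
  have "2 * 2 \<le> real A * real B" using SAB by (intro mult_mono) auto
  then have K1: "1 \<le> K" using K by simp
  have T1: "(?G1, return_pmf 0, d) \<in> MG S A B \<gamma> C" and T2: "(?G2, return_pmf 0, d) \<in> MG S A B \<gamma> C"
    unfolding d_def K_def using \<gamma> \<delta>0 \<delta>1 by (auto intro!: hard_instance_in_MG SAB C)
  have d_supp: "set_pmf d \<subseteq> {..<S} \<times> {..<A} \<times> {..<B}"
    using set_hard_data[OF SAB(2,3) K] SAB by (auto simp: d_def)
  define X where "X = flatten_transition ` (({..<S} \<times> {..<A} \<times> {..<B}) \<times> {..<S})"
  define XN where "XN = {xs. set xs \<subseteq> X \<and> length xs = N}"
  let ?P1 = "sample ?G1 d" and ?P2 = "sample ?G2 d"
  have finX: "finite X" by (simp add: X_def)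
  have finXN: "finite XN" unfolding XN_def by (rule finite_lists_length_eq[OF finX])
  have "set_pmf ?P1 \<subseteq> X" "set_pmf ?P2 \<subseteq> X"
    using T1 T2 set_pmf_sample[of ?G1 d] set_pmf_sample[of ?G2 d] by (auto simp: MG_def X_def triples_def)
  then have supp: "set_pmf (replicate_pmf N ?P1) \<subseteq> XN" "set_pmf (replicate_pmf N ?P2) \<subseteq> XN"
    by (auto simp: set_replicate_pmf XN_def)

  \<comment> \<open>Bound on the affinity lost by one sample. Here
    \<open>46656 = 216\<^sup>2\<close>, dividing by \<open>2 / 3\<close> gives \<open>69984\<close>,
    and twice that is the constant bounding \<open>N\<close>, whence \<open>N * ?h\<close> is at
    most one half.\<close>
  let ?h = "\<delta>\<^sup>2 / (\<gamma> * (1 - \<gamma>)) / K"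
  have h: "?h \<le> 69984 * ((1 - \<gamma>) ^ 3 * \<epsilon>\<^sup>2) / K"
  proof (rule divide_right_mono)
    have "\<delta>\<^sup>2 = 46656 * ((1 - \<gamma>) ^ 3 * \<epsilon>\<^sup>2) * (1 - \<gamma>)"
      by (simp add: \<delta>_def power_mult_distrib power2_eq_square power3_eq_cube)
    then have "\<delta>\<^sup>2 / (\<gamma> * (1 - \<gamma>)) = 46656 * ((1 - \<gamma>) ^ 3 * \<epsilon>\<^sup>2) / \<gamma>"
      using \<gamma> by simp
    also have "\<dots> \<le> 46656 * ((1 - \<gamma>) ^ 3 * \<epsilon>\<^sup>2) / (2 / 3)"
      using \<gamma> by (intro divide_left_mono) auto
    finally show "\<delta>\<^sup>2 / (\<gamma> * (1 - \<gamma>)) \<le> 69984 * ((1 - \<gamma>) ^ 3 * \<epsilon>\<^sup>2)"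
      by (simp add: mult_ac)
  qed (use K1 in simp)
  have hN: "real N * ?h \<le> 1 / 2"
  proof -
    have "real N * ?h \<le> real N * (69984 * ((1 - \<gamma>) ^ 3 * \<epsilon>\<^sup>2) / K)"
      by (intro mult_left_mono h) simp
    also have "\<dots> \<le> 1 / 2"
      using N K1 unfolding K_def[symmetric] by (simp add: field_simps)
    finally show ?thesis .
  qed
  have h1: "?h \<le> 1"
  proof -
    have "\<delta>\<^sup>2 \<le> \<gamma> * (1 - \<gamma>)"
      unfolding power2_eq_square using \<gamma> \<delta>0 \<delta>1 by (intro mult_mono) auto
    then have "\<delta>\<^sup>2 / (\<gamma> * (1 - \<gamma>)) \<le> 1" using \<gamma> by simp
    then have "\<delta>\<^sup>2 / (\<gamma> * (1 - \<gamma>)) \<le> 1 * K" using K1 by linarith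
    then show ?thesis using K1 by (subst pos_divide_le_eq) simp_all
  qed
  \<comment> \<open>Bernoulli's inequality turns the one-sample bound into an affinity of at least
    one half for the whole dataset.\<close>
  have "1 / 2 \<le> 1 + real N * (- ?h)" using hN by simp
  also have "\<dots> \<le> (1 + - ?h) ^ N"
    using h1 by (intro Bernoulli_inequality) simp
  also have "\<dots> \<le> affinity X ?P1 ?P2 ^ N"
  proof (rule power_mono)
    show "1 + - ?h \<le> affinity X ?P1 ?P2"
      using affinity_sample_ge[of \<gamma> \<delta> S A B d] \<gamma> \<delta>0 \<delta>1 SAB d_supp
        pmf_hard_data_0[OF SAB(2,3) K, of 0 0] by (simp add: X_def d_def)
  qed (use h1 in simp)
  also have "\<dots> = affinity XN (replicate_pmf N ?P1) (replicate_pmf N ?P2)"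
    unfolding XN_def by (rule affinity_replicate_pmf[OF finX, symmetric])
  finally have aff: "(1 / 2)\<^sup>2 \<le> (affinity XN (replicate_pmf N ?P1) (replicate_pmf N ?P2))\<^sup>2"
    by (intro power_mono) auto

  have \<epsilon>_eq: "2 / 27 * \<delta> / (1 - \<gamma>)\<^sup>2 = 16 * \<epsilon>"
    using \<gamma> by (simp add: \<delta>_def)
  have pol: "fst (est D) \<in> policies S A" "snd (est D) \<in> policies S B" for D
    using est by (auto simp: estimators_def)
  note gap = duality_gap_hard_game_lower[OF \<gamma> \<delta>0 \<delta>1 SAB pol, unfolded \<epsilon>_eq]
  \<comment> \<open>The left side is \<open>2 * \<epsilon>\<close>, so one of the two games costs
    the estimator at least \<epsilon>.\<close>
  have "16 * \<epsilon> / 2 * (1 / 2)\<^sup>2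
      \<le> 16 * \<epsilon> / 2 * (affinity XN (replicate_pmf N ?P1) (replicate_pmf N ?P2))\<^sup>2"
    using \<epsilon> by (intro mult_left_mono aff) simp
  also have "\<dots> \<le> expected_gap N est (?G1, return_pmf 0, d) + expected_gap N est (?G2, return_pmf 0, d)"
    unfolding expected_gap_def prod.case
  proof (rule two_point_bound[OF finXN supp])
    fix D
    have q: "0 \<le> pmf (fst (est D) 0) 0" "pmf (fst (est D) 0) 0 \<le> 1"
      by (auto simp: pmf_le_1)
    show "0 \<le> duality_gap ?G1 (return_pmf 0) (est D)"
      by (rule order_trans[OF _ gap(1)]) (use \<epsilon> q in simp)
    show "0 \<le> duality_gap ?G2 (return_pmf 0) (est D)"
      by (rule order_trans[OF _ gap(2)]) (use \<epsilon> q in simp)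
    show "16 * \<epsilon> \<le> duality_gap ?G1 (return_pmf 0) (est D) + duality_gap ?G2 (return_pmf 0) (est D)"
      using gap[of D] by (simp add: algebra_simps)
  qed (use \<epsilon> in simp)
  finally have "2 * \<epsilon> \<le> expected_gap N est (?G1, return_pmf 0, d) + expected_gap N est (?G2, return_pmf 0, d)"
    by (simp add: power2_eq_square)
  then have "\<epsilon> \<le> expected_gap N est (?G1, return_pmf 0, d) \<or> \<epsilon> \<le> expected_gap N est (?G2, return_pmf 0, d)"
    by linarith
  then show ?thesis using T1 T2 by blast
qed

theorem theorem2:
  shows "\<exists>c\<^sub>2 c\<^sub>\<epsilon> :: real. 0 < c\<^sub>2 \<and> 0 < c\<^sub>\<epsilon> \<and>
    (\<forall>(S::nat) (A::nat) (B::nat) (\<gamma>::real) (C::real).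
       2 \<le> S \<longrightarrow> 2 \<le> A \<longrightarrow> 2 \<le> B \<longrightarrow> 2 / 3 \<le> \<gamma> \<longrightarrow> \<gamma> < 1 \<longrightarrow>
       2 * real A * real B / (real S * (real A + real B)) \<le> C \<longrightarrow>
       (\<forall>(\<epsilon>::real) (N::nat).
          0 < \<epsilon> \<longrightarrow> \<epsilon> \<le> 1 / (c\<^sub>\<epsilon> * (1 - \<gamma>) * ln (real A + real B)) \<longrightarrow>
          real N < c\<^sub>2 * real S * (real A + real B) * C
                     / ((1 - \<gamma>) ^ 3 * \<epsilon>\<^sup>2 * ln (real A + real B)) \<longrightarrow>
          ereal \<epsilon> \<le> (INF est\<in>estimators S A B. SUP T\<in>MG S A B \<gamma> C. ereal (expected_gap N est T))))"
proof (rule exI[of _ "1 / 139968"], rule exI[of _ 432], intro conjI allI impI)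
  fix S A B N :: nat and \<gamma> C \<epsilon> :: real
  assume SAB: "2 \<le> S" "2 \<le> A" "2 \<le> B" and \<gamma>: "2 / 3 \<le> \<gamma>" "\<gamma> < 1"
    and C: "2 * real A * real B / (real S * (real A + real B)) \<le> C"
    and \<epsilon>: "0 < \<epsilon>" "\<epsilon> \<le> 1 / (432 * (1 - \<gamma>) * ln (real A + real B))"
    and N: "real N < 1 / 139968 * real S * (real A + real B) * C
                     / ((1 - \<gamma>) ^ 3 * \<epsilon>\<^sup>2 * ln (real A + real B))"
  let ?L = "ln (real A + real B)"
  have "exp 1 \<le> real A + real B"
    using exp_le SAB by simp
  then have L: "1 \<le> ?L"
    using SAB by (subst ln_ge_iff) auto
  have "432 * (1 - \<gamma>) * \<epsilon> * 1 \<le> 432 * (1 - \<gamma>) * \<epsilon> * ?L"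
    using \<gamma> \<epsilon>(1) L by (intro mult_left_mono) auto
  also have "\<dots> \<le> 1"
    using \<epsilon>(2) \<gamma> L by (subst (asm) pos_le_divide_eq) (auto simp: mult_ac)
  finally have \<epsilon>': "432 * (1 - \<gamma>) * \<epsilon> \<le> 1" by simp
  have "139968 * ((1 - \<gamma>) ^ 3 * \<epsilon>\<^sup>2) * real N * 1 \<le> 139968 * ((1 - \<gamma>) ^ 3 * \<epsilon>\<^sup>2) * real N * ?L"
    using \<gamma> L by (intro mult_left_mono) auto
  also have "\<dots> \<le> real S * (real A + real B) * C"
    using N \<gamma> L \<epsilon>(1) by (subst (asm) pos_less_divide_eq) (auto simp: mult_ac)
  finally have N': "139968 * ((1 - \<gamma>) ^ 3 * \<epsilon>\<^sup>2) * real N \<le> real S * (real A + real B) * C" by simp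
  show "ereal \<epsilon> \<le> (INF est\<in>estimators S A B. SUP T\<in>MG S A B \<gamma> C. ereal (expected_gap N est T))"
  proof (rule INF_greatest)
    fix est assume "est \<in> estimators S A B"
    from minimax_lower_bound[OF SAB \<gamma> C \<epsilon>(1) \<epsilon>' N' this]
    obtain T where "T \<in> MG S A B \<gamma> C" "\<epsilon> \<le> expected_gap N est T" by blast
    then show "ereal \<epsilon> \<le> (SUP T\<in>MG S A B \<gamma> C. ereal (expected_gap N est T))"
      by (intro SUP_upper2[of T]) auto
  qed
qed simp_all

end
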